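(* Let $X$ be a compact Riemann surface, belonging to a category $\mathcal{C}$, with $X\cong\mathbb{CP}^1$, $X$ simply connected and $\Gamma=\mathrm{Aut}_{\mathcal{C}}(X)\equiv\pi_1(X)$ trivial. Then the first singular cohomology group $H^1(X;\mathbb{C})$ is nontrivial if and only if the first de Rham cohomology group $H^1_{dR}(X)$ is nontrivial. However, since $X$ is simply connected, $H^1(X;\mathbb{C})$ vanishes, and hence the homomorphism $(f_1)^*:H^1_{dR}(X)\to H^1(X;\mathbb{C})$, $(f_1)^*([\theta^1])=\int_{c^1}\theta^1$, satisfies $$\ker\big((f_1)^*\big)=\{[\omega]\in H^1_{dR}(X):\ (f_1)^*([\omega])=0\}=H^1_{dR}(X).$$
   Context: $\Gamma$ denotes the group of deck transformations of the universal covering $\tilde X\to X$, so $X=\tilde X/\Gamma$; the paper denotes it $\mathrm{Aut}_{\mathcal{C}}(X)$ and identifies it with $\pi_1(X)$. $H^1_{dR}(X)$ is the space of closed complex-valued differential $1$-forms on $X$ modulo exact ones. The map $(f_1)^*$ is the de Rham homomorphism: under $H^1(X;\mathbb{C})\cong\mathrm{Hom}(H_1(X;\mathbb{C}),\mathbb{C})$, it sends $[\theta^1]$ to the functional $[c^1]\mapsto\int_{c^1}\theta^1$, where $c^1$ is a $1$-cycle representing the homology class $[c^1]$. *)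

theory Defs
  imports
    "HOL-Analysis.Analysis"
    "HOL-Complex_Analysis.Complex_Analysis"
    "HOL-Homology.Homology"
    "HOL-Algebra.Bij"
    "HOL-Library.Function_Algebras"
begin

section \<open>Additive quotients\<close>

text \<open>
  Forms, chains and cochains are all elements of an additive type; functions are added pointwise.
  A cohomology or homology group is the quotient group of cosets from HOL-Algebra.
\<close>

definition additive_group :: "'v::ab_group_add set \<Rightarrow> 'v monoid" where
  "additive_group Z = \<lparr>carrier = Z, monoid.mult = (+), one = 0\<rparr>"

definition additive_quotient :: "'v::ab_group_add set \<Rightarrow> 'v set \<Rightarrow> 'v set monoid" where
  "additive_quotient Z B = additive_group Z Mod B"


section \<open>Riemann surfaces\<close>

type_synonym 'a chart = "'a set \<times> ('a \<Rightarrow> complex)"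

record 'a surface =
  space_of :: "'a topology"
  atlas_of :: "'a chart set"

text \<open>
  A chart is a pair of its domain and a map of which only the values on the domain matter.
  Second countability is not required; it follows from the other conditions by Rado's theorem.
\<close>

definition chart_inv :: "'a chart \<Rightarrow> complex \<Rightarrow> 'a" where
  "chart_inv c = inv_into (fst c) (snd c)"

definition chart_image :: "'a chart \<Rightarrow> complex set" where
  "chart_image c = snd c ` fst c"

definition riemann_surface :: "'a surface \<Rightarrow> bool" where
  "riemann_surface X \<longleftrightarrow>
     topspace (space_of X) \<noteq> {} \<and> Hausdorff_space (space_of X) \<and> connected_space (space_of X) \<and>
     (\<Union>c\<in>atlas_of X. fst c) = topspace (space_of X) \<and>
     (\<forall>c\<in>atlas_of X. openin (space_of X) (fst c) \<and> open (chart_image c) \<and>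
        homeomorphic_map (subtopology (space_of X) (fst c)) (top_of_set (chart_image c)) (snd c)) \<and>
     (\<forall>c\<in>atlas_of X. \<forall>d\<in>atlas_of X.
        (snd d \<circ> chart_inv c) holomorphic_on (snd c ` (fst c \<inter> fst d)))"

definition holomorphic_map :: "'a surface \<Rightarrow> 'b surface \<Rightarrow> ('a \<Rightarrow> 'b) \<Rightarrow> bool" where
  "holomorphic_map X Y f \<longleftrightarrow>
     continuous_map (space_of X) (space_of Y) f \<and>
     (\<forall>c\<in>atlas_of X. \<forall>d\<in>atlas_of Y.
        (snd d \<circ> f \<circ> chart_inv c) holomorphic_on (snd c ` {x \<in> fst c. f x \<in> fst d}))"

definition biholomorphic :: "'a surface \<Rightarrow> 'b surface \<Rightarrow> bool" where
  "biholomorphic X Y \<longleftrightarrow>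
     (\<exists>f g. holomorphic_map X Y f \<and> holomorphic_map Y X g \<and>
        (\<forall>x\<in>topspace (space_of X). g (f x) = x) \<and> (\<forall>y\<in>topspace (space_of Y). f (g y) = y))"


subsection \<open>The complex projective line\<close>

text \<open>
  Points are the one-dimensional subspaces of \<open>\<complex>\<^sup>2\<close>, the topology is the quotient topology from
  \<open>\<complex>\<^sup>2 - {0}\<close>, and the two charts are \<open>[a : b] \<mapsto> b / a\<close> and \<open>[a : b] \<mapsto> a / b\<close>.
\<close>

definition cline :: "complex \<times> complex \<Rightarrow> (complex \<times> complex) set" where
  "cline v = range (\<lambda>t. (t * fst v, t * snd v))"

definition CP1_topology :: "(complex \<times> complex) set topology" where
  "CP1_topology = topology (\<lambda>U. U \<subseteq> cline ` (- {0}) \<and> open {v. v \<noteq> 0 \<and> cline v \<in> U})"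

definition CP1 :: "(complex \<times> complex) set surface" where
  "CP1 = \<lparr>space_of = CP1_topology,
     atlas_of = {({cline (a, b) |a b. a \<noteq> 0}, \<lambda>L. THE w. (1, w) \<in> L),
                 ({cline (a, b) |a b. b \<noteq> 0}, \<lambda>L. THE w. (w, 1) \<in> L)}\<rparr>"


section \<open>Fundamental group, coverings, deck transformations\<close>

definition loops_at :: "'a topology \<Rightarrow> 'a \<Rightarrow> (real \<Rightarrow> 'a) set" where
  "loops_at X x0 = {p. pathin X p \<and> p 0 = x0 \<and> p 1 = x0}"

definition loop_homotopic :: "'a topology \<Rightarrow> 'a \<Rightarrow> (real \<Rightarrow> 'a) rel" where
  "loop_homotopic X x0 = {(p, q). p \<in> loops_at X x0 \<and> q \<in> loops_at X x0 \<and>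
     homotopic_with (\<lambda>r. r 0 = x0 \<and> r 1 = x0) (top_of_set {0..1}) X p q}"

definition concat_path :: "(real \<Rightarrow> 'a) \<Rightarrow> (real \<Rightarrow> 'a) \<Rightarrow> real \<Rightarrow> 'a" where
  "concat_path p q = (\<lambda>t. if t \<le> 1/2 then p (2 * t) else q (2 * t - 1))"

definition fundamental_group :: "'a topology \<Rightarrow> 'a \<Rightarrow> (real \<Rightarrow> 'a) set monoid" where
  "fundamental_group X x0 =
     \<lparr>carrier = loops_at X x0 // loop_homotopic X x0,
      monoid.mult = (\<lambda>A B. loop_homotopic X x0 `` {concat_path p q |p q. p \<in> A \<and> q \<in> B}),
      one = loop_homotopic X x0 `` {\<lambda>t. x0}\<rparr>"

definition simply_connected_space :: "'a topology \<Rightarrow> bool" where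
  "simply_connected_space X \<longleftrightarrow>
     path_connected_space X \<and> (\<forall>x0\<in>topspace X. trivial_group (fundamental_group X x0))"

text \<open>The analogue of \<^const>\<open>covering_space\<close> for abstract topologies.\<close>

definition covering_map :: "'b topology \<Rightarrow> 'a topology \<Rightarrow> ('b \<Rightarrow> 'a) \<Rightarrow> bool" where
  "covering_map Y X p \<longleftrightarrow>
     continuous_map Y X p \<and> p ` topspace Y = topspace X \<and>
     (\<forall>x\<in>topspace X. \<exists>T. x \<in> T \<and> openin X T \<and>
        (\<exists>\<V>. \<Union>\<V> = {y \<in> topspace Y. p y \<in> T} \<and> (\<forall>V\<in>\<V>. openin Y V) \<and> pairwise disjnt \<V> \<and>
             (\<forall>V\<in>\<V>. homeomorphic_map (subtopology Y V) (subtopology X T) p)))"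

definition universal_covering :: "'b topology \<Rightarrow> 'a topology \<Rightarrow> ('b \<Rightarrow> 'a) \<Rightarrow> bool" where
  "universal_covering Y X p \<longleftrightarrow> covering_map Y X p \<and> simply_connected_space Y"

definition deck_group :: "'b topology \<Rightarrow> ('b \<Rightarrow> 'a) \<Rightarrow> ('b \<Rightarrow> 'b) monoid" where
  "deck_group Y p = BijGroup (topspace Y)
     \<lparr>carrier := {g \<in> extensional (topspace Y).
        homeomorphic_map Y Y g \<and> (\<forall>y\<in>topspace Y. p (g y) = p y)}\<rparr>"


section \<open>De Rham cohomology in degree one\<close>

text \<open>
  \<open>C\<^sup>k\<close> in the real sense. It is used on open subsets of the plane and on relatively open subsets
  of the unit interval; these have no isolated points, so the derivative is unique.
\<close>

primrec Ck_on :: "nat \<Rightarrow> 'v::real_normed_vector set \<Rightarrow> ('v \<Rightarrow> 'w::real_normed_vector) \<Rightarrow> bool" where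
  "Ck_on 0 S f = continuous_on S f"
| "Ck_on (Suc k) S f =
     (\<exists>f'. (\<forall>x\<in>S. (f has_derivative f' x) (at x within S)) \<and> (\<forall>v. Ck_on k S (\<lambda>x. f' x v)))"

definition smooth_on :: "'v::real_normed_vector set \<Rightarrow> ('v \<Rightarrow> 'w::real_normed_vector) \<Rightarrow> bool" where
  "smooth_on S f \<longleftrightarrow> (\<forall>k. Ck_on k S f)"

text \<open>
  A complex-valued smooth 1-form is given by its expressions in the charts: \<open>\<omega> c z v\<close> is the
  value at the point with coordinate \<open>z\<close> in the chart \<open>c\<close> on the real tangent vector with
  coordinate \<open>v\<close>. Expressions in different charts are related by pullback along the transition
  maps. Values at meaningless arguments are 0, so that equality of forms is equality in HOL.
\<close>

type_synonym 'a form1 = "'a chart \<Rightarrow> complex \<Rightarrow> complex \<Rightarrow> complex"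

definition one_forms :: "'a surface \<Rightarrow> 'a form1 set" where
  "one_forms X = {\<omega>.
     (\<forall>c\<in>atlas_of X. \<forall>z\<in>chart_image c. linear (\<omega> c z)) \<and>
     (\<forall>c\<in>atlas_of X. \<forall>v. smooth_on (chart_image c) (\<lambda>z. \<omega> c z v)) \<and>
     (\<forall>c\<in>atlas_of X. \<forall>d\<in>atlas_of X. \<forall>x\<in>fst c \<inter> fst d. \<forall>v.
        \<omega> c (snd c x) v = \<omega> d (snd d x) (deriv (snd d \<circ> chart_inv c) (snd c x) * v)) \<and>
     (\<forall>c z. \<not> (c \<in> atlas_of X \<and> z \<in> chart_image c) \<longrightarrow> \<omega> c z = 0)}"

text \<open>
  With \<open>\<omega> = a dx + b dy\<close> in a chart, the condition \<open>d\<omega> (u, v) = 0\<close> for \<open>u = 1\<close> and \<open>v = \<i>\<close>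
  says that \<open>\<partial>b/\<partial>x = \<partial>a/\<partial>y\<close>.
\<close>

definition closed_forms :: "'a surface \<Rightarrow> 'a form1 set" where
  "closed_forms X = {\<omega> \<in> one_forms X. \<forall>c\<in>atlas_of X. \<forall>z\<in>chart_image c. \<forall>u v.
     frechet_derivative (\<lambda>w. \<omega> c w v) (at z) u = frechet_derivative (\<lambda>w. \<omega> c w u) (at z) v}"

definition smooth_functions :: "'a surface \<Rightarrow> ('a \<Rightarrow> complex) set" where
  "smooth_functions X = {f. \<forall>c\<in>atlas_of X. smooth_on (chart_image c) (f \<circ> chart_inv c)}"

definition differential :: "'a surface \<Rightarrow> ('a \<Rightarrow> complex) \<Rightarrow> 'a form1" where
  "differential X f = (\<lambda>c z v.
     if c \<in> atlas_of X \<and> z \<in> chart_image c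
     then frechet_derivative (f \<circ> chart_inv c) (at z) v else 0)"

definition exact_forms :: "'a surface \<Rightarrow> 'a form1 set" where
  "exact_forms X = differential X ` smooth_functions X"

definition deRham_H1 :: "'a surface \<Rightarrow> 'a form1 set monoid" where
  "deRham_H1 X = additive_quotient (closed_forms X) (exact_forms X)"


section \<open>Singular homology and cohomology with complex coefficients\<close>

definition complex_additive :: "complex monoid" where
  "complex_additive = additive_group UNIV"

text \<open>
  Cochains are the homomorphisms from the library's integral chain group to \<open>\<complex>\<close>, extended by 0
  to arguments that are not chains in \<open>X\<close>.
\<close>

definition cochains :: "nat \<Rightarrow> 'a topology \<Rightarrow> ('a chain \<Rightarrow> complex) set" where
  "cochains p X = {\<phi> \<in> hom (chain_group p X) complex_additive.
     \<forall>c. \<not> singular_chain p X c \<longrightarrow> \<phi> c = 0}"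

definition coboundary ::
  "nat \<Rightarrow> 'a topology \<Rightarrow> ('a chain \<Rightarrow> complex) \<Rightarrow> 'a chain \<Rightarrow> complex" where
  "coboundary p X \<phi> =
     (\<lambda>c. if singular_chain (Suc p) X c then \<phi> (chain_boundary (Suc p) c) else 0)"

definition singular_cocycles :: "nat \<Rightarrow> 'a topology \<Rightarrow> ('a chain \<Rightarrow> complex) set" where
  "singular_cocycles p X = {\<phi> \<in> cochains p X. coboundary p X \<phi> = 0}"

definition singular_coboundaries :: "nat \<Rightarrow> 'a topology \<Rightarrow> ('a chain \<Rightarrow> complex) set" where
  "singular_coboundaries p X =
     (case p of 0 \<Rightarrow> {0} | Suc q \<Rightarrow> coboundary q X ` cochains q X)"

definition singular_cohomology :: "nat \<Rightarrow> 'a topology \<Rightarrow> ('a chain \<Rightarrow> complex) set monoid" where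
  "singular_cohomology p X = additive_quotient (singular_cocycles p X) (singular_coboundaries p X)"

type_synonym 'a complex_chain = "((nat \<Rightarrow> real) \<Rightarrow> 'a) \<Rightarrow>\<^sub>0 complex"

definition complex_chains :: "nat \<Rightarrow> 'a topology \<Rightarrow> 'a complex_chain set" where
  "complex_chains p X = {c. Poly_Mapping.keys c \<subseteq> singular_simplex_set p X}"

definition complex_boundary :: "nat \<Rightarrow> 'a complex_chain \<Rightarrow> 'a complex_chain" where
  "complex_boundary p c =
     (if p = 0 then 0
      else \<Sum>\<sigma>\<in>Poly_Mapping.keys c. \<Sum>k\<le>p.
        Poly_Mapping.single (singular_face p k \<sigma>) ((- 1) ^ k * Poly_Mapping.lookup c \<sigma>))"

definition complex_cycles :: "nat \<Rightarrow> 'a topology \<Rightarrow> 'a complex_chain set" where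
  "complex_cycles p X = {c \<in> complex_chains p X. complex_boundary p c = 0}"

definition complex_homology :: "nat \<Rightarrow> 'a topology \<Rightarrow> 'a complex_chain set monoid" where
  "complex_homology p X =
     additive_quotient (complex_cycles p X) (complex_boundary (Suc p) ` complex_chains (Suc p) X)"

definition evaluate :: "('a chain \<Rightarrow> complex) \<Rightarrow> 'a complex_chain \<Rightarrow> complex" where
  "evaluate \<phi> c = (\<Sum>\<sigma>\<in>Poly_Mapping.keys c. Poly_Mapping.lookup c \<sigma> * \<phi> (frag_of \<sigma>))"

text \<open>
  The universal coefficient isomorphism \<open>H\<^sup>p(X; \<complex>) \<cong> Hom (H\<^sub>p(X; \<complex>), \<complex>)\<close>, which sends
  \<open>[\<phi>]\<close> to \<open>[c] \<mapsto> \<phi> c\<close>. Functionals on homology are extended by 0.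
\<close>

definition kronecker ::
  "nat \<Rightarrow> 'a topology \<Rightarrow> ('a chain \<Rightarrow> complex) set \<Rightarrow> 'a complex_chain set \<Rightarrow> complex" where
  "kronecker p X \<Phi> A =
     (if A \<in> carrier (complex_homology p X)
      then THE r. \<forall>\<phi>\<in>\<Phi>. \<forall>c\<in>A. evaluate \<phi> c = r else 0)"


section \<open>Integration and the de Rham homomorphism\<close>

text \<open>A singular 1-simplex as a path, from the vertex 0 to the vertex 1.\<close>

definition simplex_path :: "((nat \<Rightarrow> real) \<Rightarrow> 'a) \<Rightarrow> real \<Rightarrow> 'a" where
  "simplex_path \<sigma> t = \<sigma> (\<lambda>i. if i = 0 then 1 - t else if i = 1 then t else 0)"

definition smooth_simplex1 :: "'a surface \<Rightarrow> ((nat \<Rightarrow> real) \<Rightarrow> 'a) \<Rightarrow> bool" where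
  "smooth_simplex1 X \<sigma> \<longleftrightarrow> singular_simplex 1 (space_of X) \<sigma> \<and>
     (\<forall>c\<in>atlas_of X. smooth_on {t \<in> {0..1}. simplex_path \<sigma> t \<in> fst c} (snd c \<circ> simplex_path \<sigma>))"

text \<open>The value of a form on the velocity of a path. It does not depend on the chosen chart.\<close>

definition form_on_velocity :: "'a surface \<Rightarrow> 'a form1 \<Rightarrow> (real \<Rightarrow> 'a) \<Rightarrow> real \<Rightarrow> complex" where
  "form_on_velocity X \<omega> \<gamma> t =
     (let c = SOME c. c \<in> atlas_of X \<and> \<gamma> t \<in> fst c
      in \<omega> c (snd c (\<gamma> t)) (vector_derivative (snd c \<circ> \<gamma>) (at t within {0..1})))"

definition simplex_integral :: "'a surface \<Rightarrow> 'a form1 \<Rightarrow> ((nat \<Rightarrow> real) \<Rightarrow> 'a) \<Rightarrow> complex" where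
  "simplex_integral X \<omega> \<sigma> = integral {0..1} (form_on_velocity X \<omega> (simplex_path \<sigma>))"

definition smooth_chains1 :: "'a surface \<Rightarrow> 'a complex_chain set" where
  "smooth_chains1 X = {c. \<forall>\<sigma>\<in>Poly_Mapping.keys c. smooth_simplex1 X \<sigma>}"

definition chain_integral :: "'a surface \<Rightarrow> 'a form1 \<Rightarrow> 'a complex_chain \<Rightarrow> complex" where
  "chain_integral X \<omega> c =
     (\<Sum>\<sigma>\<in>Poly_Mapping.keys c. Poly_Mapping.lookup c \<sigma> * simplex_integral X \<omega> \<sigma>)"

text \<open>
  The functional \<open>[c] \<mapsto> \<integral>\<^sub>c \<theta>\<close> on \<open>H\<^sub>1(X; \<complex>)\<close> belonging to a class \<open>\<Theta> = [\<theta>]\<close>. The integral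
  only makes sense for smooth representatives \<open>c\<close>; every class has one, and by Stokes' theorem the
  value depends neither on \<open>c\<close> nor on \<open>\<theta>\<close>.
\<close>

definition periods :: "'a surface \<Rightarrow> 'a form1 set \<Rightarrow> 'a complex_chain set \<Rightarrow> complex" where
  "periods X \<Theta> A =
     (if A \<in> carrier (complex_homology 1 (space_of X))
      then THE r. \<forall>\<theta>\<in>\<Theta>. \<forall>c\<in>A \<inter> smooth_chains1 X. chain_integral X \<theta> c = r else 0)"

definition deRham_map :: "'a surface \<Rightarrow> 'a form1 set \<Rightarrow> ('a chain \<Rightarrow> complex) set" where
  "deRham_map X \<Theta> =
     inv_into (carrier (singular_cohomology 1 (space_of X))) (kronecker 1 (space_of X)) (periods X \<Theta>)"

end

theory Submission
  imports Defs
begin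

text \<open>
  Both cohomology groups vanish, which makes everything asserted about the map between them
  immediate once the map is seen to be well defined.

  Singular side. Let \<open>\<Phi>\<close> be a function on singular 1-simplices with values in an abelian group, such
  that the alternating sum of \<open>\<Phi>\<close> over the faces of every singular 2-simplex lies in a subgroup \<open>W\<close>.
  Modulo \<open>W\<close>, concatenation of paths becomes addition and a null-homotopic loop has value 0. If the
  space is simply connected, choose a path from a base point to each point \<open>x\<close> and let \<open>\<psi> x\<close> be its
  value; then \<open>\<Phi> \<sigma>\<close> agrees modulo \<open>W\<close> with the difference of \<open>\<psi>\<close> at the two ends of \<open>\<sigma>\<close>
  (\<open>coboundary_of_points\<close>). For a cocycle and \<open>W = 0\<close> this says that 1-cocycles are coboundaries. For \<open>\<Phi> \<sigma> = \<sigma>\<close> and \<open>W\<close> the group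
  of boundaries it says that complex 1-cycles are boundaries, so that \<open>H\<^sub>1(X; \<complex>) = 0\<close> as well.

  De Rham side. The two affine charts of the projective line, carried to \<open>X\<close> by the biholomorphism,
  are holomorphic maps from the plane to \<open>X\<close> that together cover \<open>X\<close>. A closed form pulls back to a
  closed form on the plane, which has a primitive by the Poincare lemma (\<open>poincare_lemma\<close>). On the overlap, a punctured
  plane, the two primitives have the same differential, hence differ by a constant because the
  punctured plane is connected. After adding this constant they glue to a primitive on \<open>X\<close>, so every
  closed form is exact (\<open>closed_forms_exact\<close>).

  The de Rham map. Since \<open>H\<^sub>1(X; \<complex>) = 0\<close>, both the period functional of the class of exact forms and
  the functional belonging to the class of coboundaries are zero: an exact form integrates over a
  smooth 1-chain like the coboundary of its primitive, and a coboundary vanishes on boundaries. So the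
  de Rham map sends the only class to the only class (\<open>deRham_map_exact_forms\<close>).
\<close>

section \<open>Paths as singular 1-simplices\<close>

text \<open>
  The singular 1-simplex that runs along a path from the vertex 0 to the vertex 1. On
  singular 1-simplices it inverts \<^const>\<open>simplex_path\<close>; only the values of the path on the unit interval matter.
\<close>

definition edge :: "(real \<Rightarrow> 'a) \<Rightarrow> (nat \<Rightarrow> real) \<Rightarrow> 'a" where
  "edge p = restrict (\<lambda>x. p (x 1)) (standard_simplex 1)"

lemma standard_simplex_1:
  "x \<in> standard_simplex 1 \<longleftrightarrow>
     0 \<le> x 0 \<and> 0 \<le> x 1 \<and> x 0 + x 1 = 1 \<and> (\<forall>i>1. x i = 0)"
  unfolding standard_simplex_def
  apply (auto simp: numeral_2_eq_2)
  subgoal for i by (cases i; cases "i - 1"; auto)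
  subgoal for i by (cases i; cases "i - 1"; auto)
  done

lemmas standard_simplex_Suc_0 = standard_simplex_1[unfolded One_nat_def]

lemma standard_simplex_2:
  "x \<in> standard_simplex 2 \<longleftrightarrow>
     0 \<le> x 0 \<and> 0 \<le> x 1 \<and> 0 \<le> x 2 \<and> x 0 + x 1 + x 2 = 1 \<and> (\<forall>i>2. x i = 0)"
proof -
  have "0 \<le> x i \<and> x i \<le> 1" if "0 \<le> x 0" "0 \<le> x 1" "0 \<le> x 2" "x 0 + x 1 + x 2 = 1" "\<forall>i>2. x i = 0" for i
  proof -
    consider "i = 0" | "i = 1" | "i = 2" | "i > 2" by linarith
    then show ?thesis using that by cases auto
  qed
  moreover have "sum x {..2} = x 0 + x 1 + x 2" by (simp add: numeral_2_eq_2)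
  ultimately show ?thesis unfolding standard_simplex_def by auto
qed

lemma edge_cong: "(\<And>t. 0 \<le> t \<Longrightarrow> t \<le> 1 \<Longrightarrow> p t = q t) \<Longrightarrow> edge p = edge q"
  unfolding edge_def by (rule restrict_ext) (auto simp: standard_simplex_Suc_0)

lemma pathin_simplex_path:
  assumes "singular_simplex 1 X \<sigma>"
  shows "pathin X (simplex_path \<sigma>)"
proof -
  have "continuous_map (top_of_set {0..1::real}) euclideanreal
          (\<lambda>t. if k = (0::nat) then 1 - t else if k = 1 then t else 0)" for k
    by (cases "k = 0"; cases "k = 1"; auto intro!: continuous_intros)
  then have "continuous_map (top_of_set {0..1}) (subtopology (powertop_real UNIV) (standard_simplex 1))
          (\<lambda>t i. if i = 0 then 1 - t else if i = 1 then t else 0)"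
    unfolding continuous_map_in_subtopology continuous_map_componentwise_UNIV
    by (auto simp: standard_simplex_Suc_0)
  moreover have "continuous_map (subtopology (powertop_real UNIV) (standard_simplex 1)) X \<sigma>"
    using assms by (simp add: singular_simplex_def)
  ultimately have "continuous_map (top_of_set {0..1}) X
     (\<sigma> \<circ> (\<lambda>t i. if i = 0 then 1 - t else if i = 1 then t else 0))"
    by (rule continuous_map_compose)
  then show ?thesis
    by (simp add: pathin_def simplex_path_def[abs_def] o_def)
qed

lemma edge_simplex_path:
  assumes "singular_simplex 1 X \<sigma>"
  shows "edge (simplex_path \<sigma>) = \<sigma>"
proof
  fix x show "edge (simplex_path \<sigma>) x = \<sigma> x"
  proof (cases "x \<in> standard_simplex 1")
    case True
    then have "(\<lambda>i. if i = 0 then 1 - x 1 else if i = 1 then x 1 else 0) = x"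
      by (auto simp: standard_simplex_Suc_0 fun_eq_iff)
    then show ?thesis using True by (simp add: edge_def simplex_path_def del: One_nat_def)
  next
    case False
    then show ?thesis using assms
      by (simp add: edge_def singular_simplex_def extensional_def)
  qed
qed

text \<open>
  The standard 2-simplex in the coordinates belonging to the vertices 1 and 2.
\<close>

definition plane_triangle :: "(real \<times> real) set" where
  "plane_triangle = {(s, t). 0 \<le> s \<and> 0 \<le> t \<and> s + t \<le> 1}"

lemma triangle_boundary:
  assumes "continuous_map (top_of_set plane_triangle) X h"
  obtains \<tau> where "singular_simplex 2 X \<tau>"
    "singular_face 2 0 \<tau> = edge (\<lambda>t. h (1 - t, t))"
    "singular_face 2 1 \<tau> = edge (\<lambda>t. h (0, t))"
    "singular_face 2 2 \<tau> = edge (\<lambda>t. h (t, 0))"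
proof
  let ?\<tau> = "restrict (\<lambda>x. h (x 1, x 2)) (standard_simplex 2)"
  have "continuous_map (powertop_real UNIV) (euclidean :: (real \<times> real) topology) (\<lambda>x. (x (1::nat), x 2))"
        unfolding prod_topology_euclidean[symmetric] continuous_map_pairwise
    by (auto simp: o_def intro!: continuous_map_product_projection)
  then have "continuous_map (subtopology (powertop_real UNIV) (standard_simplex 2)) (top_of_set plane_triangle)
          (\<lambda>x. (x 1, x 2))"
    unfolding continuous_map_in_subtopology
    by (auto intro!: continuous_map_from_subtopology simp: standard_simplex_2 plane_triangle_def)
  from continuous_map_compose[OF this assms]
  have "continuous_map (subtopology (powertop_real UNIV) (standard_simplex 2)) X (\<lambda>x. h (x 1, x 2))"
    by (simp add: o_def)
  then have "continuous_map (subtopology (powertop_real UNIV) (standard_simplex 2)) X ?\<tau>"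
    by (rule continuous_map_eq) simp
  then show "singular_simplex 2 X ?\<tau>"
    by (simp add: singular_simplex_def)
  have *: "singular_face 2 k ?\<tau> = restrict ((\<lambda>x. h (x 1, x 2)) \<circ> simplical_face k) (standard_simplex 1)"
    if "k \<le> 2" for k using that by (subst singular_face_restrict) (simp_all add: singular_face_def)
  show "singular_face 2 0 ?\<tau> = edge (\<lambda>t. h (1 - t, t))"
    unfolding edge_def
    by (subst *, simp, rule restrict_ext) (auto simp: simplical_face_def standard_simplex_Suc_0 intro!: arg_cong[where f = h])
  show "singular_face 2 1 ?\<tau> = edge (\<lambda>t. h (0, t))"
    unfolding edge_def
    by (subst *, simp, rule restrict_ext) (auto simp: simplical_face_def)
  show "singular_face 2 2 ?\<tau> = edge (\<lambda>t. h (t, 0))"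
    unfolding edge_def
    by (subst *, simp, rule restrict_ext) (auto simp: simplical_face_def)
qed

section \<open>Additive functions on paths in a simply connected space\<close>

lemma concat_path_pathin:
  assumes "pathin X p" "pathin X q" "p 1 = q 0"
  shows "pathin X (concat_path p q)"
  unfolding pathin_def concat_path_def
proof (rule continuous_map_cases_le)
  show "continuous_map (subtopology (top_of_set {0..1}) {x \<in> topspace (top_of_set {0..1}). x \<le> 1/2})
     X (\<lambda>t. p (2 * t))"
    by (rule continuous_map_compose[OF _ assms(1)[unfolded pathin_def], of _ "\<lambda>t. 2 * t", unfolded o_def])
      (auto simp: subtopology_subtopology intro!: continuous_intros)
  show "continuous_map (subtopology (top_of_set {0..1}) {x \<in> topspace (top_of_set {0..1}). 1/2 \<le> x})
     X (\<lambda>t. q (2 * t - 1))"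
    by (rule continuous_map_compose[OF _ assms(2)[unfolded pathin_def], of _ "\<lambda>t. 2 * t - 1", unfolded o_def])
      (auto simp: subtopology_subtopology intro!: continuous_intros)
next
  fix t :: real assume "t = 1/2"
  then have "2 * t = 1" by simp
  then show "p (2 * t) = q (2 * t - 1)" using assms(3) by simp
qed auto

lemma trivial_fundamental_group_homotopic:
  assumes "trivial_group (fundamental_group X x0)" "pathin X p" "p 0 = x0" "p 1 = x0"
  shows "homotopic_with (\<lambda>r. r 0 = x0 \<and> r 1 = x0) (top_of_set {0..1}) X p (\<lambda>t. x0)"
proof -
  let ?R = "loop_homotopic X x0"
  have p: "p \<in> loops_at X x0" using assms by (simp add: loops_at_def)
  then have "?R `` {p} \<in> carrier (fundamental_group X x0)"
    by (auto simp: fundamental_group_def quotient_def)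
  then have "?R `` {p} = ?R `` {\<lambda>t. x0}"
    using assms(1) by (simp add: trivial_group_def) (simp add: fundamental_group_def)
  moreover have "(p, p) \<in> ?R"
    using assms p by (simp add: loop_homotopic_def pathin_def)
  ultimately have "(\<lambda>t. x0, p) \<in> ?R" by blast
  then show ?thesis
    by (simp add: loop_homotopic_def homotopic_with_sym)
qed

text \<open>
  A 1-cochain \<open>\<Phi>\<close> with values in an abelian group that satisfies the cocycle condition modulo the
  subgroup \<open>W\<close>.
\<close>

locale edge_cocycle =
  fixes X :: "'a topology" and \<Phi> :: "((nat \<Rightarrow> real) \<Rightarrow> 'a) \<Rightarrow> 'v::ab_group_add" and W :: "'v set"
  assumes zero: "0 \<in> W" and diff: "\<And>a b. a \<in> W \<Longrightarrow> b \<in> W \<Longrightarrow> a - b \<in> W"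
    and face: "\<And>\<tau>. singular_simplex 2 X \<tau> \<Longrightarrow>
      \<Phi> (singular_face 2 0 \<tau>) - \<Phi> (singular_face 2 1 \<tau>) + \<Phi> (singular_face 2 2 \<tau>) \<in> W"
begin

lemma add: "a \<in> W \<Longrightarrow> b \<in> W \<Longrightarrow> a + b \<in> W"
  using diff[of a "0 - b"] diff[OF zero, of b] by simp

lemma on_triangle:
  assumes "continuous_map (top_of_set plane_triangle) X h"
  shows "\<Phi> (edge (\<lambda>t. h (1 - t, t))) - \<Phi> (edge (\<lambda>t. h (0, t))) + \<Phi> (edge (\<lambda>t. h (t, 0))) \<in> W"
proof -
  obtain \<tau> where "singular_simplex 2 X \<tau>"
    "singular_face 2 0 \<tau> = edge (\<lambda>t. h (1 - t, t))"
    "singular_face 2 1 \<tau> = edge (\<lambda>t. h (0, t))"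
    "singular_face 2 2 \<tau> = edge (\<lambda>t. h (t, 0))"
    using triangle_boundary[OF assms] by blast
  with face[of \<tau>] show ?thesis by simp
qed

text \<open>
  The 2-simplex used here has the edges \<open>p\<close>, \<open>q\<close> and their concatenation.
\<close>

lemma on_concat_path:
  assumes "pathin X p" "pathin X q" "p 1 = q 0"
  shows "\<Phi> (edge q) - \<Phi> (edge (concat_path p q)) + \<Phi> (edge p) \<in> W"
proof -
  let ?h = "\<lambda>(s, t). concat_path p q (s / 2 + t)"
  have "continuous_map (top_of_set plane_triangle) (top_of_set {0..1}) (\<lambda>z. fst z / 2 + snd z)"
    by (auto simp: plane_triangle_def intro!: continuous_intros)
  from continuous_map_compose[OF this concat_path_pathin[OF assms, unfolded pathin_def]]
  have "continuous_map (top_of_set plane_triangle) X ?h"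
    by (simp add: o_def case_prod_unfold)
  note this[THEN on_triangle]
  moreover have "edge (\<lambda>t. ?h (1 - t, t)) = edge q"
    by (rule edge_cong) (use assms(3) in \<open>auto simp: concat_path_def field_simps\<close>)
  moreover have "edge (\<lambda>t. ?h (t, 0)) = edge p"
    by (rule edge_cong) (auto simp: concat_path_def)
  ultimately show ?thesis by simp
qed

text \<open>
  A null-homotopy is a map of the square. Compose it with a map from the triangle to the square that
  sends one side to the bottom edge, with the standard parametrization, and the two other sides
  into the union of the three remaining edges, on which the homotopy is constant.
\<close>

lemma on_null_homotopic_loop:
  assumes "homotopic_with (\<lambda>r. r 0 = x0 \<and> r 1 = x0) (top_of_set {0..1}) X p (\<lambda>t. x0)"
  shows "\<Phi> (edge p) \<in> W"
proof -
  have "\<exists>H::real \<times> real \<Rightarrow> 'a. continuous_map (top_of_set ({0..1} \<times> {0..1})) X H \<and>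
      (\<forall>x. H (0, x) = p x) \<and> (\<forall>x. H (1, x) = x0) \<and> (\<forall>t\<in>{0..1}. H (t, 0) = x0 \<and> H (t, 1) = x0)"
    using assms by (simp add: homotopic_with_def)
  then obtain H :: "real \<times> real \<Rightarrow> 'a" where H: "continuous_map (top_of_set ({0..1} \<times> {0..1})) X H"
    "\<And>x. H (0, x) = p x" "\<And>x. H (1, x) = x0"
    and "\<forall>t\<in>{0..1}. H (t, 0) = x0 \<and> H (t, 1) = x0"
    by blast
  then have ends: "H (t, 0) = x0" "H (t, 1) = x0" if "0 \<le> t" "t \<le> 1" for t
    using that by auto
  \<comment> \<open>The bound \<open>1/2\<close> keeps the quotient continuous at the vertex \<open>(0, 1)\<close>; where it takes
    effect, the first coordinate is already 1.\<close>
  let ?k = "\<lambda>z::real \<times> real. (min 1 (2 * snd z), fst z / max (1/2) (1 - snd z))"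
  have "?k ` plane_triangle \<subseteq> {0..1} \<times> {0..1}"
    by (auto simp: plane_triangle_def divide_le_eq)
  moreover have "continuous_on plane_triangle ?k"
    by (intro continuous_intros) (auto simp: max_def)
  ultimately have "continuous_map (top_of_set plane_triangle)
      (top_of_set ({0..1} \<times> {0..1})) ?k"
    by (auto simp: image_subset_iff_funcset)
  from continuous_map_compose[OF this H(1)]
  have "continuous_map (top_of_set plane_triangle) X (H \<circ> ?k)" .
  note * = on_triangle[OF this]
  have "edge (\<lambda>t. (H \<circ> ?k) (1 - t, t)) = edge (\<lambda>t. x0)"
  proof (rule edge_cong)
    fix t :: real assume t: "0 \<le> t" "t \<le> 1"
    show "(H \<circ> ?k) (1 - t, t) = x0"
    proof (cases "t \<le> 1/2")
      case True
      then have "max (1/2) (1 - t) = 1 - t" "1 - t \<noteq> 0" by auto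
      then show ?thesis using True t ends by simp
    next
      case False
      then have "min 1 (2 * t) = 1" by simp
      then show ?thesis using H(3) by simp
    qed
  qed
  moreover have "edge (\<lambda>t. (H \<circ> ?k) (0, t)) = edge (\<lambda>t. x0)"
    by (rule edge_cong) (simp add: ends)
  moreover have "edge (\<lambda>t. (H \<circ> ?k) (t, 0)) = edge p"
    by (rule edge_cong) (simp add: H(2))
  ultimately show ?thesis using * by simp
qed

text \<open>
  With \<open>\<gamma> x\<close> a path from the base point to \<open>x\<close>, the loop \<open>\<gamma> x\<close>, \<open>\<sigma>\<close>, reversed \<open>\<gamma> y\<close> has value 0
  modulo \<open>W\<close>, and so has \<open>\<gamma> y\<close> followed by its reverse.
\<close>

theorem coboundary_of_points:
  assumes "simply_connected_space X"
  obtains \<psi> where "\<And>\<sigma>. singular_simplex 1 X \<sigma> \<Longrightarrow>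
    \<Phi> \<sigma> - (\<psi> (simplex_path \<sigma> 1) - \<psi> (simplex_path \<sigma> 0)) \<in> W"
proof (cases "topspace X = {}")
  case True
  then show ?thesis using that[of "\<lambda>_. 0"] singular_simplex_empty by metis
next
  case False
  then obtain x0 where x0: "x0 \<in> topspace X" by blast
  have loop: "\<Phi> (edge p) \<in> W" if "pathin X p" "p 0 = x0" "p 1 = x0" for p
  proof (rule on_null_homotopic_loop[OF trivial_fundamental_group_homotopic])
    show "trivial_group (fundamental_group X x0)"
      using assms x0 by (simp add: simply_connected_space_def)
  qed (use that in auto)
  have "\<forall>x\<in>topspace X. \<exists>g. pathin X g \<and> g 0 = x0 \<and> g 1 = x"
    using assms x0 by (auto simp: simply_connected_space_def path_connected_space_def)
  then obtain \<gamma> where \<gamma>: "\<And>x. x \<in> topspace X \<Longrightarrow> pathin X (\<gamma> x)"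
    "\<And>x. x \<in> topspace X \<Longrightarrow> \<gamma> x 0 = x0" "\<And>x. x \<in> topspace X \<Longrightarrow> \<gamma> x 1 = x"
    by metis
  show ?thesis
  proof (rule that[of "\<lambda>x. \<Phi> (edge (\<gamma> x))"])
    fix \<sigma> assume \<sigma>: "singular_simplex 1 X \<sigma>"
    define p where "p = simplex_path \<sigma>"
    have p: "pathin X p" "edge p = \<sigma>"
      using \<sigma> by (simp_all add: p_def pathin_simplex_path edge_simplex_path)
    define x y where "x = p 0" and "y = p 1"
    have xy: "x \<in> topspace X" "y \<in> topspace X"
      using p(1) by (auto simp: x_def y_def path_start_in_topspace path_finish_in_topspace)
    define r where "r = \<gamma> y \<circ> (\<lambda>t. 1 - t)"
    have "continuous_map (top_of_set {0..1::real}) (top_of_set {0..1}) (\<lambda>t. 1 - t)"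
      by (auto intro!: continuous_on_diff)
    then have r: "pathin X r" unfolding r_def pathin_def
      by (rule continuous_map_compose) (use \<gamma>(1)[OF xy(2)] in \<open>simp add: pathin_def\<close>)
    have r01: "r 0 = y" "r 1 = x0" using \<gamma> xy by (auto simp: r_def)
    let ?q = "concat_path (\<gamma> x) p"
    have q: "pathin X ?q" "?q 0 = x0" "?q 1 = y"
      using concat_path_pathin[OF \<gamma>(1)[OF xy(1)] p(1)] \<gamma> xy by (auto simp: x_def concat_path_def y_def)
    have 1: "\<Phi> \<sigma> - \<Phi> (edge ?q) + \<Phi> (edge (\<gamma> x)) \<in> W"
      using on_concat_path[OF \<gamma>(1)[OF xy(1)] p(1)] \<gamma> xy p(2) by (auto simp: x_def)
    have 2: "\<Phi> (edge r) - \<Phi> (edge (concat_path ?q r)) + \<Phi> (edge ?q) \<in> W"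
      using on_concat_path[OF q(1) r] q r01 by auto
    have 3: "\<Phi> (edge (concat_path ?q r)) \<in> W"
      by (rule loop[OF concat_path_pathin[OF q(1) r]]) (use q r01 in \<open>auto simp: concat_path_def\<close>)
    have 4: "\<Phi> (edge r) - \<Phi> (edge (concat_path (\<gamma> y) r)) + \<Phi> (edge (\<gamma> y)) \<in> W"
      using on_concat_path[OF \<gamma>(1)[OF xy(2)] r] \<gamma> xy r01 by auto
    have 5: "\<Phi> (edge (concat_path (\<gamma> y) r)) \<in> W"
      by (rule loop[OF concat_path_pathin[OF \<gamma>(1)[OF xy(2)] r]])
        (use \<gamma> xy r01 in \<open>auto simp: concat_path_def\<close>)
    have "\<Phi> \<sigma> - (\<Phi> (edge (\<gamma> y)) - \<Phi> (edge (\<gamma> x))) \<in> W"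
      using diff[OF add[OF 1 add[OF 2 3]] add[OF 4 5]] by (simp add: algebra_simps del: One_nat_def)
    then show "\<Phi> \<sigma> - (\<Phi> (edge (\<gamma> (simplex_path \<sigma> 1))) - \<Phi> (edge (\<gamma> (simplex_path \<sigma> 0)))) \<in> W"
      by (simp add: x_def y_def p_def)
  qed
qed

end

section \<open>Quotients and linear extension\<close>

text \<open>
  Only \<open>Z \<subseteq> B\<close> is needed, not equality: the quotient consists of the cosets of \<open>B\<close> by elements of
  \<open>Z\<close>, and each of them is \<open>B\<close>.
\<close>

lemma trivial_additive_quotient:
  fixes Z B :: "'v::ab_group_add set"
  assumes "0 \<in> Z" "Z \<subseteq> B" and diff: "\<And>a b. a \<in> B \<Longrightarrow> b \<in> B \<Longrightarrow> a - b \<in> B"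
  shows "trivial_group (additive_quotient Z B)" "carrier (additive_quotient Z B) = {B}"
    "\<one>\<^bsub>additive_quotient Z B\<^esub> = B"
proof -
  have zero: "0 \<in> B" using assms by blast
  have neg: "- b \<in> B" if "b \<in> B" for b using diff[OF zero that] by simp
  have add: "a + b \<in> B" if "a \<in> B" "b \<in> B" for a b
    using diff[OF that(1) neg[OF that(2)]] by simp
  have "r_coset (additive_group Z) B z = B" if "z \<in> B" for z
  proof -
    have "b \<in> r_coset (additive_group Z) B z" if "b \<in> B" for b
      using diff[OF that \<open>z \<in> B\<close>] unfolding r_coset_def additive_group_def
      by (auto intro!: bexI[of _ "b - z"])
    moreover have "r_coset (additive_group Z) B z \<subseteq> B"
      using add that by (auto simp: r_coset_def additive_group_def)
    ultimately show ?thesis by blast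
  qed
  then show carr: "carrier (additive_quotient Z B) = {B}"
    using assms by (auto simp: additive_quotient_def carrier_FactGroup additive_group_def image_def)
  show one: "\<one>\<^bsub>additive_quotient Z B\<^esub> = B"
    by (simp add: additive_quotient_def)
  have mult: "B \<otimes>\<^bsub>additive_quotient Z B\<^esub> B = B"
  proof -
    have "b \<in> set_mult (additive_group Z) B B" if "b \<in> B" for b
      using that zero unfolding set_mult_def additive_group_def by force
    moreover have "set_mult (additive_group Z) B B \<subseteq> B"
      using add by (auto simp: set_mult_def additive_group_def)
    ultimately show ?thesis by (auto simp: additive_quotient_def)
  qed
  have "group (additive_quotient Z B)"
    by (rule groupI) (use carr one mult in auto)
  then show "trivial_group (additive_quotient Z B)"
    by (simp add: trivial_group_def carr one)
qed

text \<open>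
  The linear extension of a function on the basis to finite formal combinations, for a module with
  scalar multiplication \<open>s\<close>. Boundaries, evaluation of cochains and integration are all of this form.
\<close>

definition linear_extension ::
  "('r::comm_ring_1 \<Rightarrow> 'v::ab_group_add \<Rightarrow> 'v) \<Rightarrow> ('k \<Rightarrow> 'v) \<Rightarrow> ('k \<Rightarrow>\<^sub>0 'r) \<Rightarrow> 'v" where
  "linear_extension s f c = (\<Sum>k\<in>Poly_Mapping.keys c. s (Poly_Mapping.lookup c k) (f k))"

text \<open>
  Scalar multiplication on formal combinations with complex coefficients.
\<close>

definition scale_chain :: "complex \<Rightarrow> ('k \<Rightarrow>\<^sub>0 complex) \<Rightarrow> 'k \<Rightarrow>\<^sub>0 complex" where
  "scale_chain a = Poly_Mapping.map ((*) a)"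

lemma lookup_scale_chain [simp]:
  "Poly_Mapping.lookup (scale_chain a c) k = a * Poly_Mapping.lookup c k"
  by (simp add: scale_chain_def Poly_Mapping.map.rep_eq when_def)

lemma module_scale_chain: "Modules.module scale_chain"
  by unfold_locales (simp_all add: poly_mapping_eq_iff fun_eq_iff lookup_add algebra_simps)

lemma module_times: "Modules.module ((*) :: complex \<Rightarrow> complex \<Rightarrow> complex)"
  by unfold_locales (simp_all add: algebra_simps)

lemma module_of_int: "Modules.module (\<lambda>n z. of_int n * z :: complex)"
  by unfold_locales (simp_all add: algebra_simps)

context
  fixes s :: "'r::comm_ring_1 \<Rightarrow> 'v::ab_group_add \<Rightarrow> 'v"
  assumes s: "Modules.module s"
begin

interpretation Modules.module s by (fact s)

lemma linear_extension_superset: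
  assumes "finite S" "Poly_Mapping.keys c \<subseteq> S"
  shows "linear_extension s f c = (\<Sum>k\<in>S. s (Poly_Mapping.lookup c k) (f k))"
  unfolding linear_extension_def
  by (rule sum.mono_neutral_left) (use assms in \<open>auto simp: in_keys_iff\<close>)

lemma linear_extension_0: "linear_extension s f 0 = 0"
  by (simp add: linear_extension_def)

lemma linear_extension_single: "linear_extension s f (Poly_Mapping.single k a) = s a (f k)"
  by (simp add: linear_extension_def)

lemma linear_extension_add:
  "linear_extension s f (c + d) = linear_extension s f c + linear_extension s f d"
proof -
  let ?S = "Poly_Mapping.keys c \<union> Poly_Mapping.keys d"
  have "linear_extension s f (c + d) = (\<Sum>k\<in>?S. s (Poly_Mapping.lookup (c + d) k) (f k))"
    by (rule linear_extension_superset) (use Poly_Mapping.keys_add[of c d] in auto)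
  also have "\<dots> = linear_extension s f c + linear_extension s f d"
    by (simp add: linear_extension_superset[of ?S] lookup_add scale_left_distrib sum.distrib)
  finally show ?thesis .
qed

lemma linear_extension_sum:
  "linear_extension s f (\<Sum>i\<in>I. g i) = (\<Sum>i\<in>I. linear_extension s f (g i))"
  by (induction I rule: infinite_finite_induct)
    (simp_all add: linear_extension_0 linear_extension_add)

lemma linear_extension_fun_diff:
  "linear_extension s (\<lambda>k. f k - g k) c = linear_extension s f c - linear_extension s g c"
  by (simp add: linear_extension_def scale_right_diff_distrib sum_subtractf)

lemma linear_extension_mem:
  assumes "0 \<in> W" "\<And>a b. a \<in> W \<Longrightarrow> b \<in> W \<Longrightarrow> a + b \<in> W" "\<And>r a. a \<in> W \<Longrightarrow> s r a \<in> W"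
    and "\<And>k. k \<in> Poly_Mapping.keys c \<Longrightarrow> f k \<in> W"
  shows "linear_extension s f c \<in> W"
proof -
  have "(\<Sum>k\<in>S. s (Poly_Mapping.lookup c k) (f k)) \<in> W" if "finite S" "S \<subseteq> Poly_Mapping.keys c" for S
    using that by (induction S rule: finite_induct) (auto intro!: assms)
  then show ?thesis by (simp add: linear_extension_def)
qed

end

lemma linear_extension_cong:
  "(\<And>k. k \<in> Poly_Mapping.keys c \<Longrightarrow> f k = g k) \<Longrightarrow> linear_extension s f c = linear_extension s g c"
  by (simp add: linear_extension_def)

lemma linear_extension_scale:
  assumes "Modules.module s"
  shows "linear_extension s f (scale_chain a c) = s a (linear_extension s f c)"
proof -
  interpret Modules.module s by fact
  have "linear_extension s f (scale_chain a c) =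
      (\<Sum>k\<in>Poly_Mapping.keys c. s (Poly_Mapping.lookup (scale_chain a c) k) (f k))"
    by (rule linear_extension_superset) (use assms in \<open>auto simp: in_keys_iff\<close>)
  then show ?thesis
    by (simp add: linear_extension_def scale_sum_right)
qed

lemma linear_extension_compose:
  assumes "Modules.module s"
  shows "linear_extension s f (linear_extension scale_chain g c) =
    linear_extension s (\<lambda>k. linear_extension s f (g k)) c"
  unfolding linear_extension_def[of scale_chain]
  by (simp add: linear_extension_sum[OF assms] linear_extension_scale[OF assms])
    (simp add: linear_extension_def)

lemma linear_extension_of_singles:
  "linear_extension scale_chain (\<lambda>k. Poly_Mapping.single k 1) c = c"
proof (rule poly_mapping_eqI)
  fix k
  have "Poly_Mapping.lookup (linear_extension scale_chain (\<lambda>k. Poly_Mapping.single k 1) c) k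
    = (\<Sum>j\<in>Poly_Mapping.keys c. if j = k then Poly_Mapping.lookup c j else 0)"
    unfolding linear_extension_def lookup_sum
    by (rule sum.cong) (auto simp: lookup_single when_def)
  also have "\<dots> = Poly_Mapping.lookup c k"
    by (simp add: in_keys_iff)
  finally show "Poly_Mapping.lookup (linear_extension scale_chain (\<lambda>k. Poly_Mapping.single k 1) c) k
    = Poly_Mapping.lookup c k" .
qed

section \<open>Boundaries and cochains\<close>

text \<open>
  The boundary of a single simplex, as a complex chain.
\<close>

definition simplex_boundary :: "nat \<Rightarrow> ((nat \<Rightarrow> real) \<Rightarrow> 'a) \<Rightarrow> 'a complex_chain" where
  "simplex_boundary p \<sigma> = (\<Sum>k\<le>p. Poly_Mapping.single (singular_face p k \<sigma>) ((- 1) ^ k))"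

lemma complex_boundary_eq:
  assumes "p \<noteq> 0"
  shows "complex_boundary p c = linear_extension scale_chain (simplex_boundary p) c"
proof -
  have *: "scale_chain a (\<Sum>k\<in>K. g k) = (\<Sum>k\<in>K. scale_chain a (g k))" for a and g :: "nat \<Rightarrow> 'a complex_chain" and K
    using Modules.module.scale_sum_right[OF module_scale_chain] by blast
  have "scale_chain a (Poly_Mapping.single x b) = Poly_Mapping.single x (b * a)" for a b and x :: "(nat \<Rightarrow> real) \<Rightarrow> 'a"
    by (rule poly_mapping_eqI) (simp add: lookup_single when_def mult.commute)
  with assms show ?thesis
    by (simp add: complex_boundary_def linear_extension_def simplex_boundary_def *)
qed

lemma linear_extension_simplex_boundary:
  assumes "Modules.module s"
  shows "linear_extension s f (simplex_boundary 1 \<sigma>) =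
      f (singular_face 1 0 \<sigma>) - f (singular_face 1 1 \<sigma>)"
    and "linear_extension s f (simplex_boundary 2 \<tau>) =
      f (singular_face 2 0 \<tau>) - f (singular_face 2 1 \<tau>) + f (singular_face 2 2 \<tau>)"
proof -
  interpret Modules.module s by fact
  show "linear_extension s f (simplex_boundary 1 \<sigma>) =
      f (singular_face 1 0 \<sigma>) - f (singular_face 1 1 \<sigma>)"
    by (simp add: simplex_boundary_def linear_extension_sum[OF assms] linear_extension_add[OF assms]
        linear_extension_single[OF assms])
  show "linear_extension s f (simplex_boundary 2 \<tau>) =
      f (singular_face 2 0 \<tau>) - f (singular_face 2 1 \<tau>) + f (singular_face 2 2 \<tau>)"
    by (simp add: simplex_boundary_def linear_extension_sum[OF assms] linear_extension_add[OF assms]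
        linear_extension_single[OF assms] numeral_2_eq_2)
qed

text \<open>
  The function \<open>\<lambda>i. if i = 0 then 1 else 0\<close> is the only point of the standard 0-simplex.
\<close>

lemma singular_face_1_vertex:
  "singular_face 1 0 \<sigma> (\<lambda>i. if i = 0 then 1 else 0) = simplex_path \<sigma> 1"
  "singular_face 1 1 \<sigma> (\<lambda>i. if i = 0 then 1 else 0) = simplex_path \<sigma> 0"
proof -
  have "simplical_face 0 (\<lambda>i. if i = 0 then 1 else (0::real)) = (\<lambda>i. if i = 0 then 1 - 1 else if i = 1 then 1 else 0)"
    "simplical_face 1 (\<lambda>i. if i = 0 then 1 else (0::real)) = (\<lambda>i. if i = 0 then 1 - 0 else if i = 1 then 0 else 0)"
    by (auto simp: simplical_face_def fun_eq_iff)
  then show "singular_face 1 0 \<sigma> (\<lambda>i. if i = 0 then 1 else 0) = simplex_path \<sigma> 1"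
    "singular_face 1 1 \<sigma> (\<lambda>i. if i = 0 then 1 else 0) = simplex_path \<sigma> 0"
    unfolding simplex_path_def singular_face_def by simp_all
qed

lemma cochain_add:
  "\<phi> \<in> cochains p X \<Longrightarrow> singular_chain p X a \<Longrightarrow> singular_chain p X b \<Longrightarrow> \<phi> (a + b) = \<phi> a + \<phi> b"
  by (auto simp: cochains_def hom_def complex_additive_def additive_group_def)

lemma cochain_0: "\<phi> \<in> cochains p X \<Longrightarrow> \<phi> 0 = 0"
  using cochain_add[of \<phi> p X 0 0] by simp

lemma cochain_diff:
  assumes "\<phi> \<in> cochains p X" "singular_chain p X a" "singular_chain p X b"
  shows "\<phi> (a - b) = \<phi> a - \<phi> b"
  using cochain_add[OF assms(1) singular_chain_diff[OF assms(2,3)] assms(3)] by simp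

lemma cochainI:
  assumes "\<And>a b. singular_chain p X a \<Longrightarrow> singular_chain p X b \<Longrightarrow> \<phi> (a + b) = \<phi> a + \<phi> b"
    and "\<And>c. \<not> singular_chain p X c \<Longrightarrow> \<phi> c = 0"
  shows "\<phi> \<in> cochains p X"
  using assms by (auto simp: cochains_def hom_def complex_additive_def additive_group_def)

lemma chain_boundary_frag_of:
  "chain_boundary 1 (frag_of \<sigma>) = frag_of (singular_face 1 0 \<sigma>) - frag_of (singular_face 1 1 \<sigma>)"
  "chain_boundary 2 (frag_of \<tau>) = frag_of (singular_face 2 0 \<tau>) - frag_of (singular_face 2 1 \<tau>)
     + frag_of (singular_face 2 2 \<tau>)"
  by (simp_all add: chain_boundary_of numeral_2_eq_2)

lemma cochain_boundary_2:
  assumes "\<phi> \<in> cochains 1 X" "singular_simplex 2 X \<tau>"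
  shows "\<phi> (chain_boundary 2 (frag_of \<tau>)) = \<phi> (frag_of (singular_face 2 0 \<tau>))
    - \<phi> (frag_of (singular_face 2 1 \<tau>)) + \<phi> (frag_of (singular_face 2 2 \<tau>))"
proof -
  have *: "singular_chain 1 X (frag_of (singular_face 2 k \<tau>))" if "k \<le> 2" for k
    using singular_simplex_singular_face[OF assms(2) _ that] by (simp add: singular_chain_of)
  have f: "singular_chain 1 X (frag_of (singular_face 2 0 \<tau>))"
    "singular_chain 1 X (frag_of (singular_face 2 1 \<tau>))"
    "singular_chain 1 X (frag_of (singular_face 2 2 \<tau>))"
    using * by simp_all
  show ?thesis
    unfolding chain_boundary_frag_of cochain_add[OF assms(1) singular_chain_diff[OF f(1,2)] f(3)]
      cochain_diff[OF assms(1) f(1,2)] ..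
qed

text \<open>
  The 0-cochain given by a function on the points of the space.
\<close>

definition vertex_cochain :: "'a topology \<Rightarrow> ('a \<Rightarrow> complex) \<Rightarrow> 'a chain \<Rightarrow> complex" where
  "vertex_cochain X f c = (if singular_chain 0 X c
     then linear_extension (\<lambda>n z. of_int n * z) (\<lambda>v. f (v (\<lambda>i. if i = 0 then 1 else 0))) c else 0)"

lemma vertex_cochain: "vertex_cochain X f \<in> cochains 0 X"
  by (rule cochainI) (auto simp: vertex_cochain_def singular_chain_add linear_extension_add[OF module_of_int])

lemma coboundary_vertex_cochain:
  assumes "singular_simplex 1 X \<sigma>"
  shows "coboundary 0 X (vertex_cochain X f) (frag_of \<sigma>) = f (simplex_path \<sigma> 1) - f (simplex_path \<sigma> 0)"
proof -
  have f: "singular_chain 0 X (frag_of (singular_face 1 k \<sigma>))" if "k \<le> 1" for k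
    using singular_simplex_singular_face[OF assms _ that] by (simp add: singular_chain_of)
  have v: "vertex_cochain X f (frag_of (singular_face 1 k \<sigma>)) =
      f (singular_face 1 k \<sigma> (\<lambda>i. if i = 0 then 1 else 0))" if "k \<le> 1" for k
    using f[OF that] linear_extension_single[OF module_of_int, of _ "singular_face 1 k \<sigma>" 1]
    by (simp add: vertex_cochain_def del: One_nat_def)
  have "coboundary 0 X (vertex_cochain X f) (frag_of \<sigma>) =
      vertex_cochain X f (frag_of (singular_face 1 0 \<sigma>) - frag_of (singular_face 1 1 \<sigma>))"
    using assms chain_boundary_frag_of(1)[of \<sigma>] by (simp add: coboundary_def singular_chain_of)
  also have "\<dots> = vertex_cochain X f (frag_of (singular_face 1 0 \<sigma>)) - vertex_cochain X f (frag_of (singular_face 1 1 \<sigma>))"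
    by (rule cochain_diff[OF vertex_cochain]) (use f in simp_all)
  also have "\<dots> = f (simplex_path \<sigma> 1) - f (simplex_path \<sigma> 0)"
    using v singular_face_1_vertex by (metis le_refl zero_le)
  finally show ?thesis .
qed

lemma coboundary_cochain:
  assumes "\<phi> \<in> cochains p X"
  shows "coboundary p X \<phi> \<in> cochains (Suc p) X"
  by (rule cochainI)
    (auto simp: coboundary_def singular_chain_add chain_boundary_add
      intro!: cochain_add[OF assms] singular_chain_boundary_alt)

lemma cochain_eqI:
  assumes "\<phi> \<in> cochains p X" "\<psi> \<in> cochains p X"
    and "\<And>\<sigma>. singular_simplex p X \<sigma> \<Longrightarrow> \<phi> (frag_of \<sigma>) = \<psi> (frag_of \<sigma>)"
  shows "\<phi> = \<psi>"
proof
  fix c show "\<phi> c = \<psi> c"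
  proof (cases "singular_chain p X c")
    case True
    then have "Poly_Mapping.keys c \<subseteq> singular_simplex_set p X" by (simp add: singular_chain_def)
    then have "singular_chain p X c \<and> \<phi> c = \<psi> c"
    proof (induction c rule: frag_induction)
      case zero then show ?case using assms cochain_0 by (metis singular_chain_0)
    next
      case (one x) then show ?case using assms(3) by (simp add: singular_chain_of)
    next
      case (diff a b) then show ?case
        using cochain_diff[OF assms(1)] cochain_diff[OF assms(2)] singular_chain_diff by metis
    qed
    then show ?thesis ..
  next
    case False then show ?thesis using assms by (simp add: cochains_def)
  qed
qed

section \<open>Vanishing of the first cohomology and homology\<close>

lemma cocycles_subset_coboundaries:
  assumes "simply_connected_space X"
  shows "singular_cocycles 1 X \<subseteq> singular_coboundaries 1 X"
proof
  fix \<phi> assume "\<phi> \<in> singular_cocycles 1 X"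
  then have \<phi>: "\<phi> \<in> cochains 1 X" "coboundary 1 X \<phi> = 0"
    by (auto simp: singular_cocycles_def)
  interpret edge_cocycle X "\<phi> \<circ> frag_of" "{0}"
  proof
    fix \<tau> assume \<tau>: "singular_simplex 2 X \<tau>"
    have "coboundary 1 X \<phi> (frag_of \<tau>) = \<phi> (chain_boundary 2 (frag_of \<tau>))"
      using \<tau> by (simp add: coboundary_def singular_chain_of numeral_2_eq_2)
    then show "(\<phi> \<circ> frag_of) (singular_face 2 0 \<tau>) - (\<phi> \<circ> frag_of) (singular_face 2 1 \<tau>)
        + (\<phi> \<circ> frag_of) (singular_face 2 2 \<tau>) \<in> {0}"
      using \<phi>(2) cochain_boundary_2[OF \<phi>(1) \<tau>] by (simp add: zero_fun_def)
  qed auto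
  obtain f where f: "\<And>\<sigma>. singular_simplex 1 X \<sigma> \<Longrightarrow>
      \<phi> (frag_of \<sigma>) = f (simplex_path \<sigma> 1) - f (simplex_path \<sigma> 0)"
    using coboundary_of_points[OF assms] by auto
  have "\<phi> = coboundary 0 X (vertex_cochain X f)"
  proof (rule cochain_eqI[OF \<phi>(1)])
    show "coboundary 0 X (vertex_cochain X f) \<in> cochains 1 X"
      using coboundary_cochain[OF vertex_cochain] by simp
  qed (simp only: f coboundary_vertex_cochain)
  then show "\<phi> \<in> singular_coboundaries 1 X"
    using vertex_cochain by (auto simp: singular_coboundaries_def)
qed

lemma coboundaries_diff:
  assumes "\<phi> \<in> singular_coboundaries 1 X" "\<psi> \<in> singular_coboundaries 1 X"
  shows "\<phi> - \<psi> \<in> singular_coboundaries 1 X"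
proof -
  obtain \<alpha> \<beta> where *: "\<alpha> \<in> cochains 0 X" "\<phi> = coboundary 0 X \<alpha>" "\<beta> \<in> cochains 0 X" "\<psi> = coboundary 0 X \<beta>"
    using assms by (auto simp: singular_coboundaries_def)
  have "\<alpha> - \<beta> \<in> cochains 0 X"
    by (rule cochainI) (use * in \<open>auto simp: cochain_add cochains_def\<close>)
  moreover have "\<phi> - \<psi> = coboundary 0 X (\<alpha> - \<beta>)"
    by (auto simp: * coboundary_def fun_eq_iff)
  ultimately show ?thesis by (auto simp: singular_coboundaries_def)
qed

lemma zero_cochain: "0 \<in> cochains p X"
  by (rule cochainI) auto

lemma zero_cocycle: "0 \<in> singular_cocycles 1 X"
  using zero_cochain by (auto simp: singular_cocycles_def coboundary_def fun_eq_iff)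

theorem singular_cohomology_1_trivial:
  assumes "simply_connected_space X"
  shows "trivial_group (singular_cohomology 1 X)"
    and "carrier (singular_cohomology 1 X) = {singular_coboundaries 1 X}"
    and "\<one>\<^bsub>singular_cohomology 1 X\<^esub> = singular_coboundaries 1 X"
  unfolding singular_cohomology_def
  using trivial_additive_quotient[OF zero_cocycle cocycles_subset_coboundaries[OF assms] coboundaries_diff]
  by blast+

lemma complex_boundary_add: "complex_boundary p (c + d) = complex_boundary p c + complex_boundary p d"
  by (cases "p = 0")
    (simp_all add: complex_boundary_eq linear_extension_add[OF module_scale_chain], simp add: complex_boundary_def)

lemma complex_boundary_scale: "complex_boundary p (scale_chain a c) = scale_chain a (complex_boundary p c)"
proof (cases "p = 0")
  case True
  then show ?thesis using Modules.module.scale_zero_right[OF module_scale_chain, of a] by (simp add: complex_boundary_def)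
qed (simp add: complex_boundary_eq linear_extension_scale[OF module_scale_chain])

text \<open>
  The image of the boundary operator on complex chains.
\<close>

definition complex_boundaries :: "nat \<Rightarrow> 'a topology \<Rightarrow> 'a complex_chain set" where
  "complex_boundaries p X = complex_boundary (Suc p) ` complex_chains (Suc p) X"

lemma complex_boundaries_0: "0 \<in> complex_boundaries p X"
proof -
  have "complex_boundary (Suc p) 0 = (0 :: 'a complex_chain)"
    by (simp add: complex_boundary_def)
  moreover have "0 \<in> complex_chains (Suc p) X" by (simp add: complex_chains_def)
  ultimately show ?thesis unfolding complex_boundaries_def by (metis imageI)
qed

lemma complex_boundaries_add:
  assumes "a \<in> complex_boundaries p X" "b \<in> complex_boundaries p X"
  shows "a + b \<in> complex_boundaries p X"
proof -
  have "c + d \<in> complex_chains (Suc p) X" if "c \<in> complex_chains (Suc p) X" "d \<in> complex_chains (Suc p) X" for c d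
    using that Poly_Mapping.keys_add[of c d] by (auto simp: complex_chains_def)
  then show ?thesis using assms unfolding complex_boundaries_def
    by (auto simp flip: complex_boundary_add)
qed

lemma complex_boundaries_scale:
  assumes "a \<in> complex_boundaries p X"
  shows "scale_chain r a \<in> complex_boundaries p X"
proof -
  have "scale_chain r c \<in> complex_chains (Suc p) X" if "c \<in> complex_chains (Suc p) X" for c
    using that by (auto simp: complex_chains_def in_keys_iff)
  then show ?thesis using assms unfolding complex_boundaries_def
    by (auto simp flip: complex_boundary_scale)
qed

lemma complex_boundaries_diff:
  assumes "a \<in> complex_boundaries p X" "b \<in> complex_boundaries p X"
  shows "a - b \<in> complex_boundaries p X"
proof -
  have "a - b = a + scale_chain (- 1) b"
    by (rule poly_mapping_eqI) (simp add: lookup_minus lookup_add)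
  then show ?thesis using assms complex_boundaries_add complex_boundaries_scale by metis
qed

lemma complex_cycles_subset_boundaries:
  assumes "simply_connected_space X"
  shows "complex_cycles 1 X \<subseteq> complex_boundaries 1 X"
proof
  fix c assume c: "c \<in> complex_cycles 1 X"
  interpret edge_cocycle X "\<lambda>\<sigma>. Poly_Mapping.single \<sigma> 1" "complex_boundaries 1 X"
  proof
    fix \<tau> assume "singular_simplex 2 X \<tau>"
    then have "Poly_Mapping.single \<tau> 1 \<in> complex_chains 2 X" by (simp add: complex_chains_def)
    moreover have "complex_boundary 2 (Poly_Mapping.single \<tau> 1) =
      Poly_Mapping.single (singular_face 2 0 \<tau>) 1 - Poly_Mapping.single (singular_face 2 1 \<tau>) 1
        + Poly_Mapping.single (singular_face 2 2 \<tau>) 1"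
      by (simp add: complex_boundary_def numeral_2_eq_2 single_uminus)
    ultimately show "Poly_Mapping.single (singular_face 2 0 \<tau>) 1 - Poly_Mapping.single (singular_face 2 1 \<tau>) 1
        + Poly_Mapping.single (singular_face 2 2 \<tau>) 1 \<in> complex_boundaries 1 X"
      unfolding complex_boundaries_def by (metis Suc_1 imageI)
  qed (auto intro: complex_boundaries_0 complex_boundaries_diff)
  obtain \<psi> where \<psi>: "\<And>\<sigma>. singular_simplex 1 X \<sigma> \<Longrightarrow>
     Poly_Mapping.single \<sigma> 1 - (\<psi> (simplex_path \<sigma> 1) - \<psi> (simplex_path \<sigma> 0)) \<in> complex_boundaries 1 X"
    using coboundary_of_points[OF assms] by blast
  let ?d = "\<lambda>\<sigma>. \<psi> (simplex_path \<sigma> 1) - \<psi> (simplex_path \<sigma> 0)"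
  let ?v = "\<lambda>v. \<psi> (v (\<lambda>i. if i = 0 then 1 else 0))"
  have "complex_boundary 1 c = 0" using c by (simp add: complex_cycles_def)
  then have "0 = linear_extension scale_chain ?v (linear_extension scale_chain (simplex_boundary 1) c)"
    by (simp add: complex_boundary_eq linear_extension_0[OF module_scale_chain])
  also have "\<dots> = linear_extension scale_chain ?d c"
    by (simp only: linear_extension_compose[OF module_scale_chain]
        linear_extension_simplex_boundary[OF module_scale_chain] singular_face_1_vertex)
  finally have "c = linear_extension scale_chain (\<lambda>\<sigma>. Poly_Mapping.single \<sigma> 1 - ?d \<sigma>) c"
    by (simp add: linear_extension_fun_diff[OF module_scale_chain] linear_extension_of_singles)
  also have "\<dots> \<in> complex_boundaries 1 X"
  proof (rule linear_extension_mem[OF module_scale_chain])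
    fix \<sigma> assume "\<sigma> \<in> Poly_Mapping.keys c"
    then have "singular_simplex 1 X \<sigma>"
      using c by (auto simp: complex_cycles_def complex_chains_def)
    then show "Poly_Mapping.single \<sigma> 1 - ?d \<sigma> \<in> complex_boundaries 1 X" by (rule \<psi>)
  qed (auto intro: complex_boundaries_0 complex_boundaries_add complex_boundaries_scale)
  finally show "c \<in> complex_boundaries 1 X" .
qed

lemma complex_homology_1_trivial:
  assumes "simply_connected_space X"
  shows "carrier (complex_homology 1 X) = {complex_boundaries 1 X}"
proof -
  have "0 \<in> complex_cycles 1 X"
    by (simp add: complex_cycles_def complex_chains_def complex_boundary_def)
  from trivial_additive_quotient(2)[OF this complex_cycles_subset_boundaries[OF assms] complex_boundaries_diff]
  show ?thesis by (simp add: complex_homology_def complex_boundaries_def)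
qed

lemma evaluate_eq: "evaluate \<phi> = linear_extension (*) (\<lambda>\<sigma>. \<phi> (frag_of \<sigma>))"
  by (simp add: evaluate_def linear_extension_def fun_eq_iff)

lemma evaluate_coboundary_on_boundary:
  assumes "\<phi> \<in> singular_coboundaries 1 X" "c \<in> complex_boundaries 1 X"
  shows "evaluate \<phi> c = 0"
proof -
  obtain \<psi> where \<psi>: "\<psi> \<in> cochains 0 X" "\<phi> = coboundary 0 X \<psi>"
    using assms(1) by (auto simp: singular_coboundaries_def)
  have \<phi>: "\<phi> \<in> cochains 1 X" using \<psi> coboundary_cochain by fastforce
  obtain b where b: "b \<in> complex_chains 2 X" "c = complex_boundary 2 b"
    using assms(2) by (auto simp: complex_boundaries_def numeral_2_eq_2)
  have "evaluate \<phi> c = linear_extension (*) (\<lambda>\<tau>. linear_extension (*) (\<lambda>\<sigma>. \<phi> (frag_of \<sigma>)) (simplex_boundary 2 \<tau>)) b"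
    by (simp add: b evaluate_eq complex_boundary_eq linear_extension_compose[OF module_times])
  also have "\<dots> = linear_extension (*) (\<lambda>\<tau>. 0) b"
  proof (rule linear_extension_cong)
    fix \<tau> assume "\<tau> \<in> Poly_Mapping.keys b"
    then have \<tau>: "singular_simplex 2 X \<tau>" using b by (auto simp: complex_chains_def)
    have "\<phi> (chain_boundary 2 (frag_of \<tau>)) = \<psi> 0"
    proof -
      have "singular_chain (Suc 1) X (frag_of \<tau>)" using \<tau> by (simp add: singular_chain_of numeral_2_eq_2)
      then have "chain_boundary 1 (chain_boundary 2 (frag_of \<tau>)) = 0" "singular_chain 1 X (chain_boundary 2 (frag_of \<tau>))"
        using chain_boundary_boundary_alt[of 1] singular_chain_boundary_alt[of 1] by (simp_all add: numeral_2_eq_2)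
      then show ?thesis by (simp add: \<psi> coboundary_def)
    qed
    then show "linear_extension (*) (\<lambda>\<sigma>. \<phi> (frag_of \<sigma>)) (simplex_boundary 2 \<tau>) = 0"
      using cochain_boundary_2[OF \<phi> \<tau>] linear_extension_simplex_boundary(2)[OF module_times] cochain_0[OF \<psi>(1)]
      by metis
  qed
  also have "\<dots> = 0" by (simp add: linear_extension_def)
  finally show ?thesis .
qed

section \<open>Linear families and the Poincare lemma\<close>

lemma linear_Basis_expansion:
  fixes f :: "'v::euclidean_space \<Rightarrow> 'w::real_vector"
  assumes "linear f"
  shows "f v = (\<Sum>i\<in>Basis. (v \<bullet> i) *\<^sub>R f i)"
proof -
  have "f v = f (\<Sum>i\<in>Basis. (v \<bullet> i) *\<^sub>R i)" by (simp add: euclidean_representation)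
  also have "\<dots> = (\<Sum>i\<in>Basis. (v \<bullet> i) *\<^sub>R f i)"
    by (simp add: linear_sum[OF assms] linear_scale[OF assms])
  finally show ?thesis .
qed

lemma linear_derivative_of_linear_family:
  fixes \<theta> :: "'a::real_normed_vector \<Rightarrow> 'v::real_vector \<Rightarrow> 'w::real_normed_vector"
  assumes S: "open S" "z \<in> S" and lin: "\<And>z. z \<in> S \<Longrightarrow> linear (\<theta> z)"
    and der: "\<And>v. ((\<lambda>z. \<theta> z v) has_derivative (\<lambda>u. \<theta>' u v)) (at z)"
  shows "linear (\<theta>' u)"
proof (rule linearI)
  fix v w
  have "((\<lambda>z. \<theta> z (v + w)) has_derivative (\<lambda>u. \<theta>' u v + \<theta>' u w)) (at z)"
    by (rule has_derivative_transform_within_open[OF has_derivative_add[OF der der] S])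
      (simp add: linear_add[OF lin])
  from has_derivative_unique[OF der this] show "\<theta>' u (v + w) = \<theta>' u v + \<theta>' u w" by metis
next
  fix r v
  have "((\<lambda>z. \<theta> z (r *\<^sub>R v)) has_derivative (\<lambda>u. r *\<^sub>R \<theta>' u v)) (at z)"
    by (rule has_derivative_transform_within_open[OF has_derivative_scaleR_right[OF der] S])
      (simp add: linear_scale[OF lin])
  from has_derivative_unique[OF der this] show "\<theta>' u (r *\<^sub>R v) = r *\<^sub>R \<theta>' u v" by metis
qed

text \<open>
  The product rule for \<open>y \<mapsto> \<theta> (a y) (b y)\<close>, where \<open>\<theta> z\<close> is linear and only the partial maps
  \<open>z \<mapsto> \<theta> z v\<close> are assumed differentiable.
\<close>

lemma has_derivative_linear_family:
  fixes \<theta> :: "'a::real_normed_vector \<Rightarrow> 'v::euclidean_space \<Rightarrow> 'w::real_normed_vector"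
    and a :: "'x::real_normed_vector \<Rightarrow> 'a"
  assumes S: "open S" "a x \<in> S" and lin: "\<And>z. z \<in> S \<Longrightarrow> linear (\<theta> z)"
    and der: "\<And>v. ((\<lambda>z. \<theta> z v) has_derivative (\<lambda>u. \<theta>' u v)) (at (a x))"
    and a: "(a has_derivative a') (at x)" and b: "(b has_derivative b') (at x)"
  shows "((\<lambda>y. \<theta> (a y) (b y)) has_derivative (\<lambda>u. \<theta>' (a' u) (b x) + \<theta> (a x) (b' u))) (at x)"
proof -
  have "isCont a x" using a has_derivative_continuous by blast
  then obtain U where U: "open U" "x \<in> U" "\<And>y. y \<in> U \<Longrightarrow> a y \<in> S"
    using S by (metis continuous_at_open)
  have comp: "((\<lambda>y. \<theta> (a y) i) has_derivative (\<lambda>u. \<theta>' (a' u) i)) (at x)" for i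
    using has_derivative_compose[OF a der] .
  have bi: "((\<lambda>y. b y \<bullet> i) has_derivative (\<lambda>u. b' u \<bullet> i)) (at x)" for i
    by (rule has_derivative_inner_left[OF b])
  have "((\<lambda>y. \<Sum>i\<in>Basis. (b y \<bullet> i) *\<^sub>R \<theta> (a y) i) has_derivative
      (\<lambda>u. \<Sum>i\<in>Basis. (b x \<bullet> i) *\<^sub>R \<theta>' (a' u) i + (b' u \<bullet> i) *\<^sub>R \<theta> (a x) i)) (at x)"
    by (intro has_derivative_sum has_derivative_scaleR bi comp)
  moreover have "(\<Sum>i\<in>Basis. (b x \<bullet> i) *\<^sub>R \<theta>' (a' u) i + (b' u \<bullet> i) *\<^sub>R \<theta> (a x) i)
      = \<theta>' (a' u) (b x) + \<theta> (a x) (b' u)" for u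
    using linear_Basis_expansion[OF linear_derivative_of_linear_family[OF S lin der], of "a' u" "b x"]
      linear_Basis_expansion[OF lin[OF S(2)], of "b' u"]
    by (simp add: sum.distrib)
  ultimately have "((\<lambda>y. \<Sum>i\<in>Basis. (b y \<bullet> i) *\<^sub>R \<theta> (a y) i) has_derivative
      (\<lambda>u. \<theta>' (a' u) (b x) + \<theta> (a x) (b' u))) (at x)" by simp
  then show ?thesis
    by (rule has_derivative_transform_within_open[OF _ U(1,2)])
      (metis linear_Basis_expansion[OF lin] U(3))
qed

lemma continuous_on_linear_family:
  fixes \<theta> :: "'a::topological_space \<Rightarrow> 'v::euclidean_space \<Rightarrow> 'w::real_normed_vector"
  assumes lin: "\<And>z. z \<in> S \<Longrightarrow> linear (\<theta> z)" and cont: "\<And>v. continuous_on S (\<lambda>z. \<theta> z v)"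
    and a: "continuous_on T a" "a ` T \<subseteq> S" and b: "continuous_on T b"
  shows "continuous_on T (\<lambda>x. \<theta> (a x) (b x))"
proof -
  have "continuous_on T (\<lambda>x. \<Sum>i\<in>Basis. (b x \<bullet> i) *\<^sub>R \<theta> (a x) i)"
    by (intro continuous_intros b continuous_on_compose2[OF cont a])
  moreover have "(\<Sum>i\<in>Basis. (b x \<bullet> i) *\<^sub>R \<theta> (a x) i) = \<theta> (a x) (b x)" if "x \<in> T" for x
    using linear_Basis_expansion[OF lin, of "a x" "b x"] a(2) that by auto
  ultimately show ?thesis by (rule continuous_on_eq)
qed

lemma continuous_on_bilinear_family:
  fixes \<theta> :: "'a::topological_space \<Rightarrow> 'u::euclidean_space \<Rightarrow> 'v::euclidean_space \<Rightarrow> 'w::real_normed_vector"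
  assumes lin: "\<And>z v. z \<in> S \<Longrightarrow> linear (\<lambda>u. \<theta> z u v)" "\<And>z u. z \<in> S \<Longrightarrow> linear (\<theta> z u)"
    and cont: "\<And>u v. continuous_on S (\<lambda>z. \<theta> z u v)"
    and a: "continuous_on T a" "a ` T \<subseteq> S" and b: "continuous_on T b" and c: "continuous_on T c"
  shows "continuous_on T (\<lambda>x. \<theta> (a x) (b x) (c x))"
proof -
  have "continuous_on T (\<lambda>x. \<theta> (a x) i (c x))" for i
    by (rule continuous_on_linear_family[where \<theta> = "\<lambda>z. \<theta> z i", OF lin(2) cont a c])
  then have "continuous_on T (\<lambda>x. \<Sum>i\<in>Basis. (b x \<bullet> i) *\<^sub>R \<theta> (a x) i (c x))"
    by (intro continuous_intros b)
  moreover have "(\<Sum>i\<in>Basis. (b x \<bullet> i) *\<^sub>R \<theta> (a x) i (c x)) = \<theta> (a x) (b x) (c x)" if "x \<in> T" for x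
    using linear_Basis_expansion[OF lin(1)[of "a x" "c x"], of "b x"] a(2) that by auto
  ultimately show ?thesis by (rule continuous_on_eq)
qed

text \<open>
  Here \<open>\<eta>' z u v\<close> is the derivative of \<open>\<eta> z v\<close> in the direction \<open>u\<close>, so that \<open>\<eta>\<close> is closed if and only
  if \<open>\<eta>' z\<close> is symmetric. The primitive is the integral of \<open>\<eta>\<close> along the segment from 0 to \<open>x\<close>. By
  symmetry, the derivative of the integrand in the direction \<open>u\<close> is the derivative of
  \<open>t \<eta> (t x) u\<close> with respect to \<open>t\<close>.
\<close>

theorem poincare_lemma:
  fixes \<eta> :: "'v::euclidean_space \<Rightarrow> 'v \<Rightarrow> 'w::banach"
  assumes lin: "\<And>z. linear (\<eta> z)"
    and der: "\<And>z v. ((\<lambda>z. \<eta> z v) has_derivative (\<lambda>u. \<eta>' z u v)) (at z)"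
    and cont: "\<And>u v. continuous_on UNIV (\<lambda>z. \<eta>' z u v)"
    and sym: "\<And>z u v. \<eta>' z u v = \<eta>' z v u"
  obtains F where "\<And>z. (F has_derivative \<eta> z) (at z)"
proof -
  have lin1: "linear (\<lambda>u. \<eta>' z u v)" for z v
    using der has_derivative_linear by blast
  have lin2: "linear (\<eta>' z u)" for z u
    by (rule linear_derivative_of_linear_family[OF open_UNIV UNIV_I lin der])
  have cont_\<eta>: "continuous_on UNIV (\<lambda>z. \<eta> z v)" for v
    using der by (meson continuous_at_imp_continuous_on has_derivative_continuous)
  define D where "D x t u = \<eta> (t *\<^sub>R x) u + t *\<^sub>R \<eta>' (t *\<^sub>R x) x u" for x :: 'v and t :: real and u
  have linD: "bounded_linear (D x t)" for x t
    unfolding D_def linear_conv_bounded_linear[symmetric]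
    by (intro linear_compose_add lin linear_compose_scale_right lin2)
  have apply_D: "blinfun_apply (Blinfun (D x t)) = D x t" for x t
    by (rule bounded_linear_Blinfun_apply[OF linD])
  have cont_D: "continuous_on UNIV (\<lambda>p. D (fst p) (snd p) u)" for u
  proof -
    have a: "continuous_on UNIV (\<lambda>p::'v \<times> real. snd p *\<^sub>R fst p)"
      by (intro continuous_intros)
    have "continuous_on UNIV (\<lambda>p::'v \<times> real. \<eta> (snd p *\<^sub>R fst p) u)"
      by (rule continuous_on_compose2[OF cont_\<eta> a]) simp
    moreover have "continuous_on UNIV (\<lambda>p::'v \<times> real. \<eta>' (snd p *\<^sub>R fst p) (fst p) u)"
      by (rule continuous_on_bilinear_family[where \<theta> = \<eta>', OF lin1 lin2 cont a])
        (auto intro: continuous_intros)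
    ultimately show ?thesis
      unfolding D_def by (intro continuous_intros)
  qed
  define F where "F x = integral (cbox 0 1) (\<lambda>t::real. \<eta> (t *\<^sub>R x) x)" for x
  have "(F has_derivative \<eta> x) (at x)" for x
  proof -
    have 1: "((\<lambda>x. \<eta> (t *\<^sub>R x) x) has_derivative blinfun_apply (Blinfun (D x t))) (at x)" for x t
    proof -
      have "((\<lambda>x. \<eta> (t *\<^sub>R x) x) has_derivative (\<lambda>u. \<eta>' (t *\<^sub>R x) (t *\<^sub>R u) x + \<eta> (t *\<^sub>R x) u)) (at x)"
        by (rule has_derivative_linear_family[OF open_UNIV UNIV_I lin der]) (auto intro!: derivative_eq_intros)
      moreover have "(\<lambda>u. \<eta>' (t *\<^sub>R x) (t *\<^sub>R u) x + \<eta> (t *\<^sub>R x) u) = D x t"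
        by (simp add: D_def linear_scale[OF lin1] sym[of _ x] fun_eq_iff)
      ultimately show ?thesis by (simp add: apply_D)
    qed
    have 2: "(\<lambda>t. \<eta> (t *\<^sub>R x) x) integrable_on cbox 0 1" for x
    proof (rule integrable_continuous)
      have "continuous_on (cbox 0 1) (\<lambda>t::real. t *\<^sub>R x)"
        by (intro continuous_intros)
      from continuous_on_linear_family[where \<theta> = \<eta>, OF lin cont_\<eta> this _ continuous_on_const, of x]
      show "continuous_on (cbox 0 1) (\<lambda>t. \<eta> (t *\<^sub>R x) x)" by simp
    qed
    have 3: "continuous_on (UNIV \<times> cbox 0 1) (\<lambda>(x, t). Blinfun (D x t))"
    proof (rule continuous_on_subset[OF _ subset_UNIV], rule continuous_on_blinfun_componentwise)
      fix i :: 'v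
      show "continuous_on UNIV (\<lambda>p. blinfun_apply (case p of (x, t) \<Rightarrow> Blinfun (D x t)) i)"
        using cont_D[of i] by (simp add: case_prod_unfold apply_D)
    qed
    have "(F has_derivative blinfun_apply (integral (cbox 0 1) (\<lambda>t. Blinfun (D x t)))) (at x)"
      unfolding F_def using leibniz_rule[of UNIV 0 1 "\<lambda>x t. \<eta> (t *\<^sub>R x) x" "\<lambda>x t. Blinfun (D x t)" x] 1 2 3 by auto
    moreover have "blinfun_apply (integral (cbox 0 1) (\<lambda>t. Blinfun (D x t))) u = \<eta> x u" for u
    proof -
      have "continuous_on (cbox 0 1) (\<lambda>t. Blinfun (D x t))"
      proof -
        have "continuous_on (cbox 0 1) (\<lambda>t::real. (x, t))" by (intro continuous_intros)
        from continuous_on_compose2[OF 3 this] show ?thesis by auto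
      qed
      then have "blinfun_apply (integral (cbox 0 1) (\<lambda>t. Blinfun (D x t))) u
          = integral (cbox 0 1) (\<lambda>t. D x t u)"
        by (subst blinfun_apply_integral[OF integrable_continuous]) (auto simp: apply_D)
      moreover have "((\<lambda>t. D x t u) has_integral (1 *\<^sub>R \<eta> (1 *\<^sub>R x) u - 0 *\<^sub>R \<eta> (0 *\<^sub>R x) u)) {0..1}"
      proof (rule fundamental_theorem_of_calculus)
        fix t :: real
        have "((\<lambda>t. \<eta> (t *\<^sub>R x) u) has_derivative (\<lambda>h. \<eta>' (t *\<^sub>R x) (h *\<^sub>R x) u)) (at t)"
          by (rule has_derivative_compose[OF _ der]) (auto intro!: derivative_eq_intros)
        then have "((\<lambda>t. \<eta> (t *\<^sub>R x) u) has_vector_derivative \<eta>' (t *\<^sub>R x) x u) (at t)"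
          by (simp add: has_vector_derivative_def linear_scale[OF lin1])
        from has_vector_derivative_scaleR[OF DERIV_ident this]
        have "((\<lambda>t. t *\<^sub>R \<eta> (t *\<^sub>R x) u) has_vector_derivative D x t u) (at t)"
          by (simp add: D_def add.commute)
        then show "((\<lambda>t. t *\<^sub>R \<eta> (t *\<^sub>R x) u) has_vector_derivative D x t u) (at t within {0..1})"
          by (rule has_vector_derivative_at_within)
      qed simp
      ultimately show ?thesis by (simp add: integral_unique)
    qed
    ultimately show ?thesis by (metis (no_types, lifting) ext)
  qed
  then show ?thesis by (rule that)
qed

section \<open>Pulling forms back to the plane\<close>

locale surface =
  fixes X :: "'a surface"
  assumes riemann: "riemann_surface X"
begin

lemma chart_open: "c \<in> atlas_of X \<Longrightarrow> openin (space_of X) (fst c)"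
  and chart_image_open: "c \<in> atlas_of X \<Longrightarrow> open (chart_image c)"
  and chart_homeomorphic: "c \<in> atlas_of X \<Longrightarrow>
    homeomorphic_map (subtopology (space_of X) (fst c)) (top_of_set (chart_image c)) (snd c)"
  and transition_holomorphic: "c \<in> atlas_of X \<Longrightarrow> d \<in> atlas_of X \<Longrightarrow>
    (snd d \<circ> chart_inv c) holomorphic_on (snd c ` (fst c \<inter> fst d))"
  and chart_cover: "(\<Union>c\<in>atlas_of X. fst c) = topspace (space_of X)"
  using riemann unfolding riemann_surface_def by auto

lemma chart_inj: assumes "c \<in> atlas_of X" shows "inj_on (snd c) (fst c)"
proof -
  have "topspace (subtopology (space_of X) (fst c)) = fst c"
    using openin_subset[OF chart_open[OF assms]] by auto
  then show ?thesis
    using chart_homeomorphic[OF assms] homeomorphic_imp_injective_map by metis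
qed

lemma chart_inv_chart: "c \<in> atlas_of X \<Longrightarrow> x \<in> fst c \<Longrightarrow> chart_inv c (snd c x) = x"
  by (simp add: chart_inv_def chart_inj)

lemma chart_inv_in: "z \<in> chart_image c \<Longrightarrow> chart_inv c z \<in> fst c"
  and chart_chart_inv: "z \<in> chart_image c \<Longrightarrow> snd c (chart_inv c z) = z"
  by (auto simp: chart_inv_def chart_image_def inv_into_into f_inv_into_f)

lemma chart_in_image: "x \<in> fst c \<Longrightarrow> snd c x \<in> chart_image c"
  by (simp add: chart_image_def)

lemma chart_open_map:
  assumes c: "c \<in> atlas_of X" and U: "openin (space_of X) U" "U \<subseteq> fst c"
  shows "open (snd c ` U)"
proof -
  have "openin (subtopology (space_of X) (fst c)) U"
    using U by (simp add: openin_open_subtopology chart_open[OF c])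
  then have "openin (top_of_set (chart_image c)) (snd c ` U)"
    using homeomorphic_imp_open_map[OF chart_homeomorphic[OF c]] by (simp add: open_map_def)
  then show ?thesis
    using chart_image_open[OF c] openin_open_trans by blast
qed

lemma chart_at:
  assumes "x \<in> topspace (space_of X)"
  obtains c where "c \<in> atlas_of X" "x \<in> fst c"
  using assms chart_cover by blast

end

lemma openin_preimage_open:
  assumes "continuous_map euclidean Y g" "openin Y U"
  shows "open {w. g w \<in> U}"
  using openin_continuous_map_preimage[OF assms] by simp

text \<open>
  The pullback of a 1-form along a holomorphic map from the plane, expressed in an arbitrarily chosen
  chart around the image point. The choice does not matter, see \<open>pullback_in_chart\<close> below.
\<close>

definition form_pullback :: "'a surface \<Rightarrow> 'a form1 \<Rightarrow> (complex \<Rightarrow> 'a) \<Rightarrow> complex \<Rightarrow> complex \<Rightarrow> complex" where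
  "form_pullback X \<omega> g w v = (let d = SOME d. d \<in> atlas_of X \<and> g w \<in> fst d
     in \<omega> d (snd d (g w)) (deriv (snd d \<circ> g) w * v))"

text \<open>
  A holomorphic map from the plane to a Riemann surface. It need not be injective.
\<close>

locale plane_in_surface = surface +
  fixes g :: "complex \<Rightarrow> 'a"
  assumes continuous: "continuous_map euclidean (space_of X) g"
    and holomorphic: "\<And>d. d \<in> atlas_of X \<Longrightarrow> (snd d \<circ> g) holomorphic_on {w. g w \<in> fst d}"
begin

lemma in_space: "g w \<in> topspace (space_of X)"
  using continuous by (auto simp: continuous_map_def)

lemma open_domain: "d \<in> atlas_of X \<Longrightarrow> open {w. g w \<in> fst d}"
  by (rule openin_preimage_open[OF continuous chart_open])

lemma pullback_in_chart:
  assumes \<omega>: "\<omega> \<in> one_forms X" and d: "d \<in> atlas_of X" "g w \<in> fst d"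
  shows "form_pullback X \<omega> g w v = \<omega> d (snd d (g w)) (deriv (snd d \<circ> g) w * v)"
proof -
  define c where "c = (SOME d. d \<in> atlas_of X \<and> g w \<in> fst d)"
  have "c \<in> atlas_of X \<and> g w \<in> fst c"
    unfolding c_def by (rule someI[of _ d]) (simp add: d)
  then have c: "c \<in> atlas_of X" "g w \<in> fst c" by auto
  let ?t = "snd d \<circ> chart_inv c" and ?O = "{w. g w \<in> fst c} \<inter> {w. g w \<in> fst d}"
  have O: "open ?O" "w \<in> ?O"
    using open_Int[OF open_domain[OF c(1)] open_domain[OF d(1)]] c d by auto
  have "openin (space_of X) (fst c \<inter> fst d)" using chart_open c d by blast
  then have T: "open (snd c ` (fst c \<inter> fst d))" using chart_open_map c(1) by blast
  have "(?t has_field_derivative deriv ?t (snd c (g w))) (at ((snd c \<circ> g) w))"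
    using holomorphic_derivI[OF transition_holomorphic[OF c(1) d(1)] T] c d by auto
  moreover have "((snd c \<circ> g) has_field_derivative deriv (snd c \<circ> g) w) (at w)"
    by (rule holomorphic_derivI[OF holomorphic[OF c(1)] open_domain[OF c(1)]]) (simp add: c)
  ultimately have "(?t \<circ> (snd c \<circ> g) has_field_derivative
      deriv ?t (snd c (g w)) * deriv (snd c \<circ> g) w) (at w)"
    by (rule DERIV_chain)
  then have "((snd d \<circ> g) has_field_derivative
      deriv ?t (snd c (g w)) * deriv (snd c \<circ> g) w) (at w)"
    by (rule has_field_derivative_transform_within_open[OF _ O]) (simp add: chart_inv_chart c(1))
  then have "deriv (snd d \<circ> g) w = deriv ?t (snd c (g w)) * deriv (snd c \<circ> g) w"
    by (rule DERIV_imp_deriv)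
  moreover have "\<omega> c (snd c (g w)) u = \<omega> d (snd d (g w)) (deriv ?t (snd c (g w)) * u)" for u
    using \<omega> c d unfolding one_forms_def by blast
  ultimately show ?thesis
    by (simp add: form_pullback_def flip: c_def) (simp add: mult.assoc)
qed

end

lemma (in surface) closed_form_in_chart:
  assumes \<omega>: "\<omega> \<in> closed_forms X" and c: "c \<in> atlas_of X"
  obtains \<theta>' where
    "\<And>z v. z \<in> chart_image c \<Longrightarrow> ((\<lambda>z. \<omega> c z v) has_derivative (\<lambda>u. \<theta>' z u v)) (at z)"
    "\<And>u v. continuous_on (chart_image c) (\<lambda>z. \<theta>' z u v)"
    "\<And>z u v. z \<in> chart_image c \<Longrightarrow> \<theta>' z u v = \<theta>' z v u"
proof -
  let ?S = "chart_image c"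
  define \<theta>' where "\<theta>' z u v = frechet_derivative (\<lambda>z. \<omega> c z v) (at z) u" for z u v
  have smooth: "Ck_on (Suc (Suc 0)) ?S (\<lambda>z. \<omega> c z v)" for v
    using \<omega> c unfolding closed_forms_def one_forms_def smooth_on_def by blast
  have 1: "((\<lambda>z. \<omega> c z v) has_derivative (\<lambda>u. \<theta>' z u v)) (at z)"
    and 2: "continuous_on ?S (\<lambda>z. \<theta>' z u v)" if "z \<in> ?S" for z u v
  proof -
    obtain f' where f': "\<And>z. z \<in> ?S \<Longrightarrow> ((\<lambda>z. \<omega> c z v) has_derivative f' z) (at z within ?S)"
      "\<And>u. Ck_on (Suc 0) ?S (\<lambda>z. f' z u)"
      using smooth[of v] unfolding Ck_on.simps(2)[of "Suc 0"] by blast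
    have der: "((\<lambda>z. \<omega> c z v) has_derivative f' z) (at z)" if "z \<in> ?S" for z
      using f'(1)[OF that] at_within_open[OF that chart_image_open[OF c]] by simp
    then have eq: "f' z = (\<lambda>u. \<theta>' z u v)" if "z \<in> ?S" for z
      unfolding \<theta>'_def using frechet_derivative_at that by (metis (no_types, lifting) ext)
    show "((\<lambda>z. \<omega> c z v) has_derivative (\<lambda>u. \<theta>' z u v)) (at z)"
      using der[OF that] eq[OF that] by simp
    have "continuous_on ?S (\<lambda>z. f' z u)"
      using f'(2)[of u] unfolding Ck_on.simps by (blast intro: has_derivative_continuous_on)
    then show "continuous_on ?S (\<lambda>z. \<theta>' z u v)"
      by (rule continuous_on_eq) (simp add: eq)
  qed
  show ?thesis
  proof (rule that[of \<theta>'])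
    show "continuous_on ?S (\<lambda>z. \<theta>' z u v)" for u v
      using 2 by (cases "?S = {}") auto
    show "\<theta>' z u v = \<theta>' z v u" if "z \<in> ?S" for z u v
      using \<omega> c that unfolding closed_forms_def \<theta>'_def by blast
  qed (rule 1)
qed

context plane_in_surface
begin

lemma pullback_has_primitive:
  assumes \<omega>: "\<omega> \<in> closed_forms X"
  obtains F where "\<And>w. (F has_derivative form_pullback X \<omega> g w) (at w)"
proof -
  let ?\<eta> = "form_pullback X \<omega> g"
  have form: "\<omega> \<in> one_forms X" using \<omega> by (simp add: closed_forms_def)
  \<comment> \<open>Differentiability, continuity of the derivative and closedness are local on the plane, so
    they may be checked in one chart. There \<open>\<eta>\<close> is the pullback along a holomorphic function \<open>k\<close>, and
    the term of its derivative that contains \<open>k''\<close> is symmetric since it depends on \<open>u * v\<close>.\<close>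
  define \<eta>' where "\<eta>' w u v = frechet_derivative (\<lambda>w. ?\<eta> w v) (at w) u" for w u v
  have local: "linear (?\<eta> w)"
    "((\<lambda>w. ?\<eta> w v) has_derivative (\<lambda>u. \<eta>' w u v)) (at w)"
    "isCont (\<lambda>w. \<eta>' w u v) w" "\<eta>' w u v = \<eta>' w v u" for w u v
  proof -
    obtain d where d: "d \<in> atlas_of X" "g w \<in> fst d" using chart_at[OF in_space] .
    obtain \<theta>' where \<theta>': "\<And>z v. z \<in> chart_image d \<Longrightarrow> ((\<lambda>z. \<omega> d z v) has_derivative (\<lambda>u. \<theta>' z u v)) (at z)"
      "\<And>u v. continuous_on (chart_image d) (\<lambda>z. \<theta>' z u v)"
      "\<And>z u v. z \<in> chart_image d \<Longrightarrow> \<theta>' z u v = \<theta>' z v u"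
      using closed_form_in_chart[OF \<omega> d(1)] by blast
    let ?O = "{w. g w \<in> fst d}" and ?k = "snd d \<circ> g" and ?S = "chart_image d"
    have O: "open ?O" "w \<in> ?O" using open_domain d by auto
    have k: "?k y \<in> ?S" if "y \<in> ?O" for y using that by (simp add: chart_in_image)
    have k_holo: "?k holomorphic_on ?O" by (rule holomorphic[OF d(1)])
    have k'_holo: "deriv ?k holomorphic_on ?O" by (rule holomorphic_deriv[OF k_holo O(1)])
    have k''_holo: "deriv (deriv ?k) holomorphic_on ?O" by (rule holomorphic_deriv[OF k'_holo O(1)])
    have S: "open ?S" by (rule chart_image_open[OF d(1)])
    have lin: "linear (\<omega> d z)" if "z \<in> ?S" for z
      using form d(1) that by (auto simp: one_forms_def)
    have \<eta>: "?\<eta> y v = \<omega> d (?k y) (deriv ?k y * v)" if "y \<in> ?O" for y v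
      using pullback_in_chart[OF form d(1)] that by simp
    let ?D = "\<lambda>y u v. \<theta>' (?k y) (deriv ?k y * u) (deriv ?k y * v) + \<omega> d (?k y) (deriv (deriv ?k) y * u * v)"
    have D: "((\<lambda>w. ?\<eta> w v) has_derivative (\<lambda>u. ?D y u v)) (at y)" if y: "y \<in> ?O" for y v
    proof -
      have "(?k has_derivative (*) (deriv ?k y)) (at y)"
        using holomorphic_derivI[OF k_holo O(1) y] by (simp add: has_field_derivative_def)
      moreover have "(deriv ?k has_derivative (*) (deriv (deriv ?k) y)) (at y)"
        using holomorphic_derivI[OF k'_holo O(1) y] by (simp add: has_field_derivative_def)
      then have "((\<lambda>y. deriv ?k y * v) has_derivative (\<lambda>u. deriv (deriv ?k) y * u * v)) (at y)"
        by (rule has_derivative_mult_left)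
      ultimately have "((\<lambda>y. \<omega> d (?k y) (deriv ?k y * v)) has_derivative (\<lambda>u. ?D y u v)) (at y)"
        by (intro has_derivative_linear_family[where a = ?k and x = y, OF S k[OF y] lin \<theta>'(1)[OF k[OF y]]])
      then show ?thesis
        by (rule has_derivative_transform_within_open[OF _ O(1) y]) (simp add: \<eta>)
    qed
    have \<eta>': "\<eta>' y u v = ?D y u v" if "y \<in> ?O" for y u v
      unfolding \<eta>'_def using fun_cong[OF frechet_derivative_at[OF D[OF that]], of u] by simp
    have "linear (\<lambda>v. \<omega> d (?k w) (deriv ?k w * v))"
      using linear_compose[OF linear_times lin[OF k[OF O(2)]]] by (simp add: o_def)
    moreover have "?\<eta> w = (\<lambda>v. \<omega> d (?k w) (deriv ?k w * v))"
      by (rule ext) (rule \<eta>[OF O(2)])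
    ultimately show "linear (?\<eta> w)" by simp
    show "((\<lambda>w. ?\<eta> w v) has_derivative (\<lambda>u. \<eta>' w u v)) (at w)"
      using D[OF O(2)] \<eta>'[OF O(2)] by simp
    show "\<eta>' w u v = \<eta>' w v u"
      using \<eta>'[OF O(2)] \<theta>'(3)[OF k[OF O(2)]] by (simp add: mult.assoc mult.commute[of u])
    have lin1: "linear (\<lambda>u. \<theta>' z u v)" if "z \<in> ?S" for z v
      using \<theta>'(1)[OF that] has_derivative_linear by blast
    have lin2: "linear (\<theta>' z u)" if "z \<in> ?S" for z u
      by (rule linear_derivative_of_linear_family[OF S that lin \<theta>'(1)[OF that]])
    have cont_\<omega>: "continuous_on ?S (\<lambda>z. \<omega> d z v)" for v
      using \<theta>'(1) by (meson continuous_at_imp_continuous_on has_derivative_continuous)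
    note cont_k = k_holo[THEN holomorphic_on_imp_continuous_on]
      k'_holo[THEN holomorphic_on_imp_continuous_on] k''_holo[THEN holomorphic_on_imp_continuous_on]
    have k_img: "?k ` ?O \<subseteq> ?S" using k by blast
    have "continuous_on ?O (\<lambda>y. \<theta>' (?k y) (deriv ?k y * u) (deriv ?k y * v))"
      by (rule continuous_on_bilinear_family[where \<theta> = \<theta>', OF lin1 lin2 \<theta>'(2) cont_k(1) k_img])
        (assumption | intro continuous_on_mult cont_k(2) continuous_on_const)+
    moreover have "continuous_on ?O (\<lambda>y. \<omega> d (?k y) (deriv (deriv ?k) y * u * v))"
      by (rule continuous_on_linear_family[where \<theta> = "\<omega> d", OF lin cont_\<omega> cont_k(1) k_img])
        (assumption | intro continuous_on_mult cont_k(3) continuous_on_const)+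
    ultimately have "continuous_on ?O (\<lambda>y. ?D y u v)"
      by (rule continuous_on_add)
    then have "continuous_on ?O (\<lambda>y. \<eta>' y u v)"
      by (rule continuous_on_eq) (simp add: \<eta>')
    then show "isCont (\<lambda>w. \<eta>' w u v) w"
      using O continuous_on_eq_continuous_at by blast
  qed
  have "continuous_on UNIV (\<lambda>w. \<eta>' w u v)" for u v
    using local(3) by (simp add: continuous_at_imp_continuous_on)
  then obtain F where "\<And>w. (F has_derivative ?\<eta> w) (at w)"
    using poincare_lemma[of ?\<eta> \<eta>'] local(1,2,4) by blast
  then show ?thesis by (rule that)
qed

text \<open>
  If \<open>\<mu>\<close> is a local inverse of the map \<open>g\<close> from the plane, expressed in a chart, then a primitive of
  the pulled back form composed with \<open>\<mu>\<close> is a local primitive of the form in this chart.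
\<close>

lemma primitive_in_chart:
  assumes \<omega>: "\<omega> \<in> one_forms X" and F: "\<And>w. (F has_derivative form_pullback X \<omega> g w) (at w)"
    and c: "c \<in> atlas_of X" and T: "open T" "T \<subseteq> chart_image c" "z \<in> T"
    and \<mu>: "\<mu> holomorphic_on T" "\<And>z. z \<in> T \<Longrightarrow> g (\<mu> z) = chart_inv c z"
  shows "((F \<circ> \<mu>) has_derivative \<omega> c z) (at z)"
proof -
  have gz: "g (\<mu> z) \<in> fst c" "snd c (g (\<mu> z)) = z"
    using \<mu>(2)[OF T(3)] T chart_inv_in[of z c] chart_chart_inv[of z c] by auto
  have \<mu>': "(\<mu> has_field_derivative deriv \<mu> z) (at z)"
    by (rule holomorphic_derivI[OF \<mu>(1) T(1,3)])
  moreover have "((snd c \<circ> g) has_field_derivative deriv (snd c \<circ> g) (\<mu> z)) (at (\<mu> z))"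
    by (rule holomorphic_derivI[OF holomorphic[OF c] open_domain[OF c]]) (simp add: gz)
  ultimately have "((snd c \<circ> g) \<circ> \<mu> has_field_derivative deriv (snd c \<circ> g) (\<mu> z) * deriv \<mu> z) (at z)"
    by (metis DERIV_chain)
  then have "((\<lambda>z. z) has_field_derivative deriv (snd c \<circ> g) (\<mu> z) * deriv \<mu> z) (at z)"
    by (rule has_field_derivative_transform_within_open[OF _ T(1,3)])
      (use \<mu>(2) T(2) chart_chart_inv[of _ c] in auto)
  then have one: "deriv (snd c \<circ> g) (\<mu> z) * deriv \<mu> z = 1"
    using DERIV_unique DERIV_ident by blast
  have "((F \<circ> \<mu>) has_derivative (form_pullback X \<omega> g (\<mu> z) \<circ> (*) (deriv \<mu> z))) (at z)"
    by (rule diff_chain_at[OF _ F]) (use \<mu>' in \<open>simp add: has_field_derivative_def\<close>)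
  moreover have "form_pullback X \<omega> g (\<mu> z) \<circ> (*) (deriv \<mu> z) = \<omega> c z"
    using pullback_in_chart[OF \<omega> c gz(1)] gz(2) one by (auto simp: fun_eq_iff simp flip: mult.assoc)
  ultimately show ?thesis by simp
qed

lemma pullback_reparametrized:
  assumes \<omega>: "\<omega> \<in> one_forms X" and h: "plane_in_surface X h"
    and j: "open S" "w \<in> S" "j holomorphic_on S" "\<And>w. w \<in> S \<Longrightarrow> h (j w) = g w"
  shows "form_pullback X \<omega> g w v = form_pullback X \<omega> h (j w) (deriv j w * v)"
proof -
  interpret h: plane_in_surface X h by fact
  obtain d where d: "d \<in> atlas_of X" "g w \<in> fst d" using chart_at[OF in_space] .
  have "(j has_field_derivative deriv j w) (at w)"
    by (rule holomorphic_derivI[OF j(3,1,2)])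
  moreover have "((snd d \<circ> h) has_field_derivative deriv (snd d \<circ> h) (j w)) (at (j w))"
    by (rule holomorphic_derivI[OF h.holomorphic[OF d(1)] h.open_domain[OF d(1)]]) (use d j in auto)
  ultimately have "((snd d \<circ> h) \<circ> j has_field_derivative deriv (snd d \<circ> h) (j w) * deriv j w) (at w)"
    by (metis DERIV_chain)
  then have "((snd d \<circ> g) has_field_derivative deriv (snd d \<circ> h) (j w) * deriv j w) (at w)"
    by (rule has_field_derivative_transform_within_open[OF _ j(1,2)]) (simp add: j(4))
  then have "deriv (snd d \<circ> g) w = deriv (snd d \<circ> h) (j w) * deriv j w"
    by (rule DERIV_imp_deriv)
  then show ?thesis
    using pullback_in_chart[OF \<omega> d] h.pullback_in_chart[OF \<omega> d(1), of "j w"] d j(2,4)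
    by (simp add: mult.assoc)
qed

end

section \<open>The affine charts of the projective line\<close>

lemma cline_scale:
  assumes "r \<noteq> 0"
  shows "cline (r * a, r * b) = cline (a, b)"
proof -
  have "(t * a, t * b) \<in> range (\<lambda>t. (t * (r * a), t * (r * b)))" for t
    using assms by (intro image_eqI[of _ _ "t / r"]) auto
  moreover have "(t * (r * a), t * (r * b)) \<in> range (\<lambda>t. (t * a, t * b))" for t
    by (intro image_eqI[of _ _ "t * r"]) (auto simp: mult.assoc)
  ultimately show ?thesis by (auto simp: cline_def)
qed

lemma mem_cline: "(a, b) \<in> cline (a, b)"
  unfolding cline_def by (rule image_eqI[of _ _ 1]) auto

lemma one_mem_cline: "(1, w) \<in> cline (a, b) \<longleftrightarrow> a \<noteq> 0 \<and> w = b / a"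
proof
  assume "(1, w) \<in> cline (a, b)"
  then obtain t where "1 = t * a" "w = t * b" by (auto simp: cline_def)
  then show "a \<noteq> 0 \<and> w = b / a" by (cases "a = 0") (auto simp: field_simps)
next
  assume *: "a \<noteq> 0 \<and> w = b / a"
  then have "cline (a, b) = cline (1, w)" using cline_scale[of a 1 w] by simp
  then show "(1, w) \<in> cline (a, b)" using mem_cline by simp
qed

lemma mem_one_cline: "(w, 1) \<in> cline (a, b) \<longleftrightarrow> b \<noteq> 0 \<and> w = a / b"
proof
  assume "(w, 1) \<in> cline (a, b)"
  then obtain t where "1 = t * b" "w = t * a" by (auto simp: cline_def)
  then show "b \<noteq> 0 \<and> w = a / b" by (cases "b = 0") (auto simp: field_simps)
next
  assume *: "b \<noteq> 0 \<and> w = a / b"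
  then have "cline (a, b) = cline (w, 1)" using cline_scale[of b w 1] by simp
  then show "(w, 1) \<in> cline (a, b)" using mem_cline by simp
qed

text \<open>
  The affine chart \<open>[a : b] \<mapsto> b / a\<close>.
\<close>

definition CP1_chart0 :: "(complex \<times> complex) set chart" where
  "CP1_chart0 = ({cline (a, b) |a b. a \<noteq> 0}, \<lambda>L. THE w. (1, w) \<in> L)"

text \<open>
  The affine chart \<open>[a : b] \<mapsto> a / b\<close>.
\<close>

definition CP1_chart1 :: "(complex \<times> complex) set chart" where
  "CP1_chart1 = ({cline (a, b) |a b. b \<noteq> 0}, \<lambda>L. THE w. (w, 1) \<in> L)"

lemma atlas_CP1: "atlas_of CP1 = {CP1_chart0, CP1_chart1}"
  by (simp add: CP1_def CP1_chart0_def CP1_chart1_def)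

lemma space_CP1: "space_of CP1 = CP1_topology"
  by (simp add: CP1_def)

lemma cline_mem_chart0: "cline (a, b) \<in> fst CP1_chart0 \<longleftrightarrow> a \<noteq> 0"
proof
  assume "cline (a, b) \<in> fst CP1_chart0"
  then obtain a' b' where "cline (a, b) = cline (a', b')" "a' \<noteq> 0" by (auto simp: CP1_chart0_def)
  then show "a \<noteq> 0" using one_mem_cline by metis
qed (auto simp: CP1_chart0_def)

lemma cline_mem_chart1: "cline (a, b) \<in> fst CP1_chart1 \<longleftrightarrow> b \<noteq> 0"
proof
  assume "cline (a, b) \<in> fst CP1_chart1"
  then obtain a' b' where "cline (a, b) = cline (a', b')" "b' \<noteq> 0" by (auto simp: CP1_chart1_def)
  then show "b \<noteq> 0" using mem_one_cline by metis
qed (auto simp: CP1_chart1_def)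

lemma CP1_chart0_cline: "a \<noteq> 0 \<Longrightarrow> snd CP1_chart0 (cline (a, b)) = b / a"
  by (simp add: CP1_chart0_def one_mem_cline)

lemma CP1_chart1_cline: "b \<noteq> 0 \<Longrightarrow> snd CP1_chart1 (cline (a, b)) = a / b"
  by (simp add: CP1_chart1_def mem_one_cline)

lemma cline_CP1_chart0:
  assumes "L \<in> fst CP1_chart0" shows "cline (1, snd CP1_chart0 L) = L"
proof -
  obtain a b where "L = cline (a, b)" "a \<noteq> 0" using assms by (auto simp: CP1_chart0_def)
  then show ?thesis using cline_scale[of a 1 "b / a"] by (simp add: CP1_chart0_cline)
qed

lemma cline_CP1_chart1:
  assumes "L \<in> fst CP1_chart1" shows "cline (snd CP1_chart1 L, 1) = L"
proof -
  obtain a b where "L = cline (a, b)" "b \<noteq> 0" using assms by (auto simp: CP1_chart1_def)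
  then show ?thesis using cline_scale[of b "a / b" 1] by (simp add: CP1_chart1_cline)
qed

lemma openin_CP1:
  "openin CP1_topology U \<longleftrightarrow> U \<subseteq> cline ` (- {0}) \<and> open {v. v \<noteq> 0 \<and> cline v \<in> U}"
proof -
  have "istopology (\<lambda>U. U \<subseteq> cline ` (- {0}) \<and> open {v. v \<noteq> 0 \<and> cline v \<in> U})"
    unfolding istopology_def
  proof (intro conjI allI impI)
    fix S T assume "S \<subseteq> cline ` (- {0}) \<and> open {v. v \<noteq> 0 \<and> cline v \<in> S}"
      "T \<subseteq> cline ` (- {0}) \<and> open {v. v \<noteq> 0 \<and> cline v \<in> T}"
    moreover have "{v. v \<noteq> 0 \<and> cline v \<in> S \<inter> T} = {v. v \<noteq> 0 \<and> cline v \<in> S} \<inter> {v. v \<noteq> 0 \<and> cline v \<in> T}" by auto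
    ultimately show "S \<inter> T \<subseteq> cline ` (- {0})" "open {v. v \<noteq> 0 \<and> cline v \<in> S \<inter> T}"
      by (auto simp: open_Int)
  next
    fix K assume K: "\<forall>S\<in>K. S \<subseteq> cline ` (- {0}) \<and> open {v. v \<noteq> 0 \<and> cline v \<in> S}"
    then show "\<Union>K \<subseteq> cline ` (- {0})" by blast
    have "{v. v \<noteq> 0 \<and> cline v \<in> \<Union>K} = (\<Union>S\<in>K. {v. v \<noteq> 0 \<and> cline v \<in> S})" by auto
    with K show "open {v. v \<noteq> 0 \<and> cline v \<in> \<Union>K}" by auto
  qed
  then show ?thesis by (simp add: CP1_topology_def topology_inverse')
qed

lemma topspace_CP1: "topspace CP1_topology = cline ` (- {0})"
proof -
  have "{v. v \<noteq> 0 \<and> cline v \<in> cline ` (- {0})} = - {0}" by auto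
  then have "openin CP1_topology (cline ` (- {0}))" by (simp add: openin_CP1 open_Compl)
  then have "cline ` (- {0}) \<subseteq> topspace CP1_topology" by (rule openin_subset)
  moreover have "topspace CP1_topology \<subseteq> cline ` (- {0})"
    using openin_CP1[of "topspace CP1_topology"] openin_topspace by blast
  ultimately show ?thesis by blast
qed

lemma openin_CP1_chart0: "openin CP1_topology (fst CP1_chart0)"
proof -
  have "{v. v \<noteq> 0 \<and> cline v \<in> fst CP1_chart0} = fst -` (- {0})"
    by (auto simp: cline_mem_chart0 zero_prod_def)
  moreover have "open (fst -` (- {0::complex}) :: (complex \<times> complex) set)"
    by (intro open_vimage_fst open_Compl closed_singleton)
  moreover have "fst CP1_chart0 \<subseteq> cline ` (- {0})"
    by (auto simp: CP1_chart0_def zero_prod_def)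
  ultimately show ?thesis by (simp add: openin_CP1)
qed

lemma openin_CP1_chart1: "openin CP1_topology (fst CP1_chart1)"
proof -
  have "{v. v \<noteq> 0 \<and> cline v \<in> fst CP1_chart1} = snd -` (- {0})"
    by (auto simp: cline_mem_chart1 zero_prod_def)
  moreover have "open (snd -` (- {0::complex}) :: (complex \<times> complex) set)"
    by (intro open_vimage_snd open_Compl closed_singleton)
  moreover have "fst CP1_chart1 \<subseteq> cline ` (- {0})"
    by (auto simp: CP1_chart1_def zero_prod_def)
  ultimately show ?thesis by (simp add: openin_CP1)
qed

lemma CP1_covered: "topspace CP1_topology \<subseteq> fst CP1_chart0 \<union> fst CP1_chart1"
  by (auto simp: topspace_CP1 cline_mem_chart0 cline_mem_chart1 zero_prod_def)

lemma continuous_map_cline: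
  fixes h :: "complex \<Rightarrow> complex \<times> complex"
  assumes "continuous_on UNIV h" "\<And>w. h w \<noteq> 0"
  shows "continuous_map euclidean CP1_topology (\<lambda>w. cline (h w))"
  unfolding continuous_map_def
proof (intro conjI allI impI)
  show "(\<lambda>w. cline (h w)) \<in> topspace euclidean \<rightarrow> topspace CP1_topology"
    using assms(2) by (auto simp: topspace_CP1)
  fix U assume "openin CP1_topology U"
  then have "open {v. v \<noteq> 0 \<and> cline v \<in> U}" by (simp add: openin_CP1)
  then have "open (h -` {v. v \<noteq> 0 \<and> cline v \<in> U})" by (rule open_vimage[OF _ assms(1)])
  moreover have "h -` {v. v \<noteq> 0 \<and> cline v \<in> U} = {w. cline (h w) \<in> U}"
    using assms(2) by auto
  ultimately show "openin euclidean {w \<in> topspace euclidean. cline (h w) \<in> U}" by simp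
qed

section \<open>Closed forms are exact\<close>

text \<open>
  A chart of \<open>Y\<close> onto the whole plane, with inverse \<open>r\<close>, composed with a holomorphic map from \<open>Y\<close> to
  \<open>X\<close>.
\<close>

lemma plane_in_surface_of_chart:
  assumes X: "riemann_surface X" and G: "holomorphic_map Y X G" and e: "e \<in> atlas_of Y"
    and r: "continuous_map euclidean (space_of Y) r"
    and r_in: "\<And>w. r w \<in> fst e" "\<And>w. snd e (r w) = w" and r_inv: "\<And>y. y \<in> fst e \<Longrightarrow> r (snd e y) = y"
  shows "plane_in_surface X (\<lambda>w. G (r w))"
proof
  show "riemann_surface X" by (rule X)
  show "continuous_map euclidean (space_of X) (\<lambda>w. G (r w))"
    using continuous_map_compose[OF r] G by (auto simp: holomorphic_map_def o_def)
  fix d assume d: "d \<in> atlas_of X"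
  have hol: "(snd d \<circ> G \<circ> chart_inv e) holomorphic_on (snd e ` {y \<in> fst e. G y \<in> fst d})"
    using G e d by (simp add: holomorphic_map_def)
  have inj: "inj_on (snd e) (fst e)" by (metis inj_onI r_inv)
  have "chart_inv e = r"
    unfolding chart_inv_def by (rule ext) (metis inj inv_into_f_f r_in)
  moreover have "snd e ` {y \<in> fst e. G y \<in> fst d} = {w. G (r w) \<in> fst d}"
  proof (intro equalityI subsetI)
    fix w assume "w \<in> {w. G (r w) \<in> fst d}"
    then show "w \<in> snd e ` {y \<in> fst e. G y \<in> fst d}"
      using r_in by (intro image_eqI[of _ _ "r w"]) auto
  qed (auto simp: r_inv)
  ultimately show "(snd d \<circ> (\<lambda>w. G (r w))) holomorphic_on {w. G (r w) \<in> fst d}"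
    using hol by (simp add: o_def)
qed

lemma smooth_on_of_smooth_derivative:
  assumes "\<And>z. z \<in> S \<Longrightarrow> (f has_derivative \<eta> z) (at z within S)" "\<And>v. smooth_on S (\<lambda>z. \<eta> z v)"
  shows "smooth_on S f"
  unfolding smooth_on_def
proof
  fix k show "Ck_on k S f"
  proof (cases k)
    case 0 then show ?thesis using has_derivative_continuous_on[of S f \<eta>] assms(1) by simp
  next
    case (Suc m) then show ?thesis using assms by (auto simp: smooth_on_def)
  qed
qed

theorem (in surface) closed_forms_exact:
  assumes CP1: "biholomorphic X CP1"
  shows "closed_forms X \<subseteq> exact_forms X"
proof
  fix \<omega> assume \<omega>: "\<omega> \<in> closed_forms X"
  then have form: "\<omega> \<in> one_forms X" by (simp add: closed_forms_def)
  obtain A G where A: "holomorphic_map X CP1 A" and G: "holomorphic_map CP1 X G"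
    and GA: "\<And>x. x \<in> topspace (space_of X) \<Longrightarrow> G (A x) = x"
    using CP1 unfolding biholomorphic_def by blast
  have A_in: "A x \<in> topspace CP1_topology" if "x \<in> topspace (space_of X)" for x
    using A that by (auto simp: holomorphic_map_def continuous_map_def space_CP1)
  define g0 where "g0 w = G (cline (1, w))" for w
  define g1 where "g1 w = G (cline (w, 1))" for w
  interpret g0: plane_in_surface X g0
    unfolding g0_def
  proof (rule plane_in_surface_of_chart[OF riemann G, of CP1_chart0])
    show "continuous_map euclidean (space_of CP1) (\<lambda>w. cline (1, w))"
      unfolding space_CP1 by (rule continuous_map_cline) (auto intro!: continuous_intros simp: zero_prod_def)
  qed (auto simp: atlas_CP1 cline_mem_chart0 CP1_chart0_cline cline_CP1_chart0)
  interpret g1: plane_in_surface X g1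
    unfolding g1_def
  proof (rule plane_in_surface_of_chart[OF riemann G, of CP1_chart1])
    show "continuous_map euclidean (space_of CP1) (\<lambda>w. cline (w, 1))"
      unfolding space_CP1 by (rule continuous_map_cline) (auto intro!: continuous_intros simp: zero_prod_def)
  qed (auto simp: atlas_CP1 cline_mem_chart1 CP1_chart1_cline cline_CP1_chart1)
  obtain P0 where P0: "\<And>w. (P0 has_derivative form_pullback X \<omega> g0 w) (at w)"
    using g0.pullback_has_primitive[OF \<omega>] by blast
  obtain P1 where P1: "\<And>w. (P1 has_derivative form_pullback X \<omega> g1 w) (at w)"
    using g1.pullback_has_primitive[OF \<omega>] by blast
  have g_inverse: "g1 (inverse w) = g0 w" if "w \<noteq> 0" for w
    using cline_scale[of "inverse w" 1 w] that by (simp add: g0_def g1_def)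
  have "((\<lambda>w. P0 w - P1 (inverse w)) has_derivative (\<lambda>v. 0)) (at w)" if w: "w \<in> - {0}" for w
  proof -
    have holo: "inverse holomorphic_on - {0::complex}"
      by (rule holomorphic_on_inverse[OF holomorphic_on_ident, unfolded id_def]) auto
    have "(inverse has_derivative (*) (deriv inverse w)) (at w)"
      using holomorphic_derivI[OF holo _ w] by (simp add: has_field_derivative_def open_Compl)
    from has_derivative_compose[OF this P1]
    have "((\<lambda>w. P1 (inverse w)) has_derivative
        (\<lambda>v. form_pullback X \<omega> g1 (inverse w) (deriv inverse w * v))) (at w)" .
    moreover have "form_pullback X \<omega> g0 w v = form_pullback X \<omega> g1 (inverse w) (deriv inverse w * v)" for v
      by (rule g0.pullback_reparametrized[OF form g1.plane_in_surface_axioms _ w holo])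
        (use g_inverse in \<open>auto simp: open_Compl\<close>)
    ultimately show ?thesis
      using has_derivative_diff[OF P0[of w]] by fastforce
  qed
  moreover have "connected (- {0::complex})"
    by (rule connected_punctured_universe) simp
  ultimately have const: "P0 w - P1 (inverse w) = P0 1 - P1 (inverse 1)" if "w \<noteq> 0" for w
    using has_derivative_zero_unique_connected[of "- {0}" "\<lambda>w. P0 w - P1 (inverse w)" w 1] that
    by (simp add: open_Compl)
  \<comment> \<open>The two primitives differ by \<open>k\<close> on the whole overlap of the affine charts.\<close>
  define k where "k = P0 1 - P1 1"
  define f where "f x = (if A x \<in> fst CP1_chart0 then P0 (snd CP1_chart0 (A x))
     else P1 (snd CP1_chart1 (A x)) + k)" for x
  have f1: "f x = P1 (snd CP1_chart1 (A x)) + k" if "A x \<in> fst CP1_chart1" for x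
  proof (cases "A x \<in> fst CP1_chart0")
    case True
    then obtain a b where ab: "A x = cline (a, b)" "a \<noteq> 0" by (auto simp: CP1_chart0_def)
    with that have "b \<noteq> 0" by (simp add: cline_mem_chart1)
    with ab True const[of "b / a"] show ?thesis
      by (simp add: f_def CP1_chart0_cline CP1_chart1_cline k_def algebra_simps)
  qed (simp add: f_def)
  have f_deriv: "((f \<circ> chart_inv c) has_derivative \<omega> c z) (at z)"
    if c: "c \<in> atlas_of X" and z: "z \<in> chart_image c" for c z
  proof -
    have local: "((P \<circ> (snd e \<circ> A \<circ> chart_inv c)) has_derivative \<omega> c z) (at z)
        \<and> open (snd c ` {x \<in> fst c. A x \<in> fst e}) \<and> z \<in> snd c ` {x \<in> fst c. A x \<in> fst e}"
      if e: "e \<in> atlas_of CP1" "openin CP1_topology (fst e)" "A (chart_inv c z) \<in> fst e"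
        and g: "plane_in_surface X g" "\<And>w. (P has_derivative form_pullback X \<omega> g w) (at w)"
        and ge: "\<And>L. L \<in> fst e \<Longrightarrow> g (snd e L) = G L"
      for e g P
    proof -
      interpret g: plane_in_surface X g by fact
      let ?T = "snd c ` {x \<in> fst c. A x \<in> fst e}"
      have "openin (space_of X) {x \<in> topspace (space_of X). A x \<in> fst e}"
        using A e(2) by (intro openin_continuous_map_preimage) (auto simp: holomorphic_map_def space_CP1)
      then have "openin (space_of X) (fst c \<inter> {x \<in> topspace (space_of X). A x \<in> fst e})"
        using chart_open[OF c] by blast
      moreover have "fst c \<inter> {x \<in> topspace (space_of X). A x \<in> fst e} = {x \<in> fst c. A x \<in> fst e}"
        using openin_subset[OF chart_open[OF c]] by auto
      ultimately have T: "open ?T" using chart_open_map[OF c] by auto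
      have Tsub: "?T \<subseteq> chart_image c" by (auto simp: chart_image_def)
      have zT: "z \<in> ?T" using e(3) chart_inv_in[OF z] chart_chart_inv[OF z] by force
      have "((P \<circ> (snd e \<circ> A \<circ> chart_inv c)) has_derivative \<omega> c z) (at z)"
      proof (rule g.primitive_in_chart[OF form g(2) c T Tsub zT])
        show "(snd e \<circ> A \<circ> chart_inv c) holomorphic_on ?T"
          using A c e(1) by (auto simp: holomorphic_map_def)
        fix y assume "y \<in> ?T"
        then obtain x where x: "x \<in> fst c" "A x \<in> fst e" "y = snd c x" by blast
        then have "x \<in> topspace (space_of X)" using openin_subset[OF chart_open[OF c]] by auto
        with x show "g ((snd e \<circ> A \<circ> chart_inv c) y) = chart_inv c y"
          by (simp add: chart_inv_chart[OF c] ge GA)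
      qed
      with T zT show ?thesis by blast
    qed
    have "chart_inv c z \<in> topspace (space_of X)"
      using chart_inv_in[OF z] openin_subset[OF chart_open[OF c]] by blast
    from A_in[OF this] CP1_covered consider "A (chart_inv c z) \<in> fst CP1_chart0" | "A (chart_inv c z) \<in> fst CP1_chart1"
      by blast
    then show ?thesis
    proof cases
      case 1
      let ?T = "snd c ` {x \<in> fst c. A x \<in> fst CP1_chart0}"
      have *: "((P0 \<circ> (snd CP1_chart0 \<circ> A \<circ> chart_inv c)) has_derivative \<omega> c z) (at z) \<and> open ?T \<and> z \<in> ?T"
        by (rule local[OF _ openin_CP1_chart0 1 g0.plane_in_surface_axioms P0])
          (auto simp: atlas_CP1 g0_def cline_CP1_chart0)
      show ?thesis
      proof (rule has_derivative_transform_within_open[where s = ?T])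
        fix y assume "y \<in> ?T"
        then obtain x where "x \<in> fst c" "A x \<in> fst CP1_chart0" "y = snd c x" by blast
        then show "(P0 \<circ> (snd CP1_chart0 \<circ> A \<circ> chart_inv c)) y = (f \<circ> chart_inv c) y"
          by (simp add: chart_inv_chart[OF c] f_def)
      qed (use * in blast)+
    next
      case 2
      let ?T = "snd c ` {x \<in> fst c. A x \<in> fst CP1_chart1}"
      have *: "((P1 \<circ> (snd CP1_chart1 \<circ> A \<circ> chart_inv c)) has_derivative \<omega> c z) (at z) \<and> open ?T \<and> z \<in> ?T"
        by (rule local[OF _ openin_CP1_chart1 2 g1.plane_in_surface_axioms P1])
          (auto simp: atlas_CP1 g1_def cline_CP1_chart1)
      then have "((\<lambda>z. (P1 \<circ> (snd CP1_chart1 \<circ> A \<circ> chart_inv c)) z + k) has_derivative \<omega> c z) (at z)"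
        using has_derivative_add[OF _ has_derivative_const[of k]] by fastforce
      then show ?thesis
      proof (rule has_derivative_transform_within_open[where s = ?T])
        fix y assume "y \<in> ?T"
        then obtain x where "x \<in> fst c" "A x \<in> fst CP1_chart1" "y = snd c x" by blast
        then show "(P1 \<circ> (snd CP1_chart1 \<circ> A \<circ> chart_inv c)) y + k = (f \<circ> chart_inv c) y"
          by (simp add: chart_inv_chart[OF c] f1)
      qed (use * in blast)+
    qed
  qed
  have "f \<in> smooth_functions X"
    unfolding smooth_functions_def
  proof (intro CollectI ballI)
    fix c assume c: "c \<in> atlas_of X"
    show "smooth_on (chart_image c) (f \<circ> chart_inv c)"
    proof (rule smooth_on_of_smooth_derivative)
      show "((f \<circ> chart_inv c) has_derivative \<omega> c z) (at z within chart_image c)" if "z \<in> chart_image c" for z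
        using f_deriv[OF c that] by (rule has_derivative_at_withinI)
      show "smooth_on (chart_image c) (\<lambda>z. \<omega> c z v)" for v
        using form c by (auto simp: one_forms_def)
    qed
  qed
  moreover have "differential X f = \<omega>"
  proof (intro ext)
    fix c z v
    show "differential X f c z v = \<omega> c z v"
    proof (cases "c \<in> atlas_of X \<and> z \<in> chart_image c")
      case True
      then have "\<omega> c z = frechet_derivative (f \<circ> chart_inv c) (at z)"
        using f_deriv frechet_derivative_at by blast
      then show ?thesis
        unfolding differential_def if_P[OF True] by (rule fun_cong[OF sym])
    next
      case False
      then have "\<omega> c z = 0" using form unfolding one_forms_def by blast
      with False show ?thesis by (auto simp: differential_def)
    qed
  qed
  ultimately show "\<omega> \<in> exact_forms X" by (auto simp: exact_forms_def)
qed

section \<open>Vanishing of the first de Rham group\<close>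

lemma Ck_on_diff:
  assumes "Ck_on k S f" "Ck_on k S g"
  shows "Ck_on k S (\<lambda>x. f x - g x)"
  using assms
proof (induction k arbitrary: f g)
  case 0 then show ?case by (simp add: continuous_on_diff)
next
  case (Suc k)
  obtain f' g' where *: "\<forall>x\<in>S. (f has_derivative f' x) (at x within S)" "\<forall>v. Ck_on k S (\<lambda>x. f' x v)"
    "\<forall>x\<in>S. (g has_derivative g' x) (at x within S)" "\<forall>v. Ck_on k S (\<lambda>x. g' x v)"
    using Suc.prems by auto
  show ?case unfolding Ck_on.simps
    by (rule exI[of _ "\<lambda>x v. f' x v - g' x v"]) (use * Suc.IH in \<open>auto intro: has_derivative_diff\<close>)
qed

lemma smooth_on_0:
  fixes S :: "'v::real_normed_vector set"
  shows "smooth_on S (\<lambda>x. 0 :: 'w::real_normed_vector)"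
proof -
  have "Ck_on k S (\<lambda>x. 0 :: 'w)" for k
  proof (induction k)
    case (Suc k)
    then show ?case unfolding Ck_on.simps by (intro exI[of _ "\<lambda>x v. 0"]) auto
  qed simp
  then show ?thesis by (simp add: smooth_on_def)
qed

lemma zero_closed_form: "0 \<in> closed_forms X"
proof -
  have "linear ((0 :: 'a form1) c z)" for c z
    by (rule linearI) simp_all
  then show ?thesis
    unfolding closed_forms_def one_forms_def by (simp add: smooth_on_0 frechet_derivative_const)
qed

context surface
begin

lemma smooth_function_derivative:
  assumes f: "f \<in> smooth_functions X" and c: "c \<in> atlas_of X" and z: "z \<in> chart_image c"
  shows "((f \<circ> chart_inv c) has_derivative differential X f c z) (at z)"
proof -
  have "Ck_on (Suc 0) (chart_image c) (f \<circ> chart_inv c)"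
    using f c unfolding smooth_functions_def smooth_on_def by blast
  then obtain f' where "((f \<circ> chart_inv c) has_derivative f') (at z within chart_image c)"
    using z by auto
  then have "(f \<circ> chart_inv c) differentiable (at z)"
    using at_within_open[OF z chart_image_open[OF c]] by (auto simp: differentiable_def)
  then have "((f \<circ> chart_inv c) has_derivative frechet_derivative (f \<circ> chart_inv c) (at z)) (at z)"
    by (simp add: frechet_derivative_works)
  then show ?thesis using c z by (simp add: differential_def)
qed

lemma exact_forms_diff:
  assumes "\<omega> \<in> exact_forms X" "\<eta> \<in> exact_forms X"
  shows "\<omega> - \<eta> \<in> exact_forms X"
proof -
  obtain f g where fg: "f \<in> smooth_functions X" "\<omega> = differential X f"
    "g \<in> smooth_functions X" "\<eta> = differential X g"
    using assms by (auto simp: exact_forms_def)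
  have comp: "(\<lambda>x. f x - g x) \<circ> h = (\<lambda>z. (f \<circ> h) z - (g \<circ> h) z)" for h :: "complex \<Rightarrow> 'a"
    by auto
  have "(\<lambda>x. f x - g x) \<in> smooth_functions X"
    unfolding smooth_functions_def smooth_on_def
  proof (intro CollectI ballI allI)
    fix c k assume c: "c \<in> atlas_of X"
    then have "Ck_on k (chart_image c) (f \<circ> chart_inv c)" "Ck_on k (chart_image c) (g \<circ> chart_inv c)"
      using fg(1,3) by (auto simp: smooth_functions_def smooth_on_def)
    from Ck_on_diff[OF this]
    show "Ck_on k (chart_image c) ((\<lambda>x. f x - g x) \<circ> chart_inv c)" unfolding comp .
  qed
  moreover have "differential X (\<lambda>x. f x - g x) = \<omega> - \<eta>"
  proof (intro ext)
    fix c z v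
    show "differential X (\<lambda>x. f x - g x) c z v = (\<omega> - \<eta>) c z v"
    proof (cases "c \<in> atlas_of X \<and> z \<in> chart_image c")
      case True
      then have "(((\<lambda>x. f x - g x) \<circ> chart_inv c) has_derivative (\<lambda>v. \<omega> c z v - \<eta> c z v)) (at z)"
        unfolding comp fg(2,4)
        using smooth_function_derivative[OF fg(1)] smooth_function_derivative[OF fg(3)]
        by (intro has_derivative_diff) blast+
      then have "(\<lambda>v. \<omega> c z v - \<eta> c z v) = frechet_derivative ((\<lambda>x. f x - g x) \<circ> chart_inv c) (at z)"
        by (rule frechet_derivative_at)
      from fun_cong[OF this, of v] have "differential X (\<lambda>x. f x - g x) c z v = \<omega> c z v - \<eta> c z v"
        unfolding differential_def if_P[OF True] by (rule sym)
      then show ?thesis by simp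
    next
      case False
      have "(\<omega> - \<eta>) c z v = \<omega> c z v - \<eta> c z v" by simp
      then show ?thesis unfolding fg(2,4) differential_def if_not_P[OF False] by simp
    qed
  qed
  ultimately show ?thesis
    unfolding exact_forms_def by (intro image_eqI[OF sym])
qed

theorem deRham_H1_trivial:
  assumes "biholomorphic X CP1"
  shows "trivial_group (deRham_H1 X)" "carrier (deRham_H1 X) = {exact_forms X}"
    "\<one>\<^bsub>deRham_H1 X\<^esub> = exact_forms X"
  unfolding deRham_H1_def
  using trivial_additive_quotient[OF zero_closed_form closed_forms_exact[OF assms] exact_forms_diff]
  by blast+

section \<open>Integration of exact forms and the de Rham map\<close>

lemma has_vector_derivative_along_path:
  assumes f: "f \<in> smooth_functions X" and \<sigma>: "smooth_simplex1 X \<sigma>" and t: "t \<in> {0..1}"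
  shows "((f \<circ> simplex_path \<sigma>) has_vector_derivative
    form_on_velocity X (differential X f) (simplex_path \<sigma>) t) (at t within {0..1})"
proof -
  let ?\<gamma> = "simplex_path \<sigma>"
  have path: "continuous_map (top_of_set {0..1}) (space_of X) ?\<gamma>"
    using \<sigma> pathin_simplex_path by (auto simp: smooth_simplex1_def pathin_def)
  define c where "c = (SOME c. c \<in> atlas_of X \<and> ?\<gamma> t \<in> fst c)"
  have "?\<gamma> t \<in> topspace (space_of X)"
    using path t by (auto simp: continuous_map_def)
  then obtain d where "d \<in> atlas_of X \<and> ?\<gamma> t \<in> fst d" using chart_at by blast
  then have "c \<in> atlas_of X \<and> ?\<gamma> t \<in> fst c" unfolding c_def by (rule someI)
  then have c: "c \<in> atlas_of X" "?\<gamma> t \<in> fst c" by auto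
  let ?I = "{t \<in> {0..1}. ?\<gamma> t \<in> fst c}"
  have tI: "t \<in> ?I" using t c by simp
  have "openin (top_of_set {0..1}) ?I"
    using openin_continuous_map_preimage[OF path chart_open[OF c(1)]] by simp
  then obtain V where V: "open V" "?I = V \<inter> {0..1}" by (auto simp: openin_open)
  have at: "at t within ?I = at t within {0..1}"
    using V tI by (intro at_within_nhd[of _ V]) auto
  have "Ck_on (Suc 0) ?I (snd c \<circ> ?\<gamma>)"
    using \<sigma> c(1) unfolding smooth_simplex1_def smooth_on_def by blast
  then obtain D where "((snd c \<circ> ?\<gamma>) has_derivative D) (at t within ?I)"
    unfolding Ck_on.simps(2) using tI by blast
  then have "(snd c \<circ> ?\<gamma>) differentiable (at t within {0..1})"
    unfolding at by (rule differentiableI)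
  then have v: "((snd c \<circ> ?\<gamma>) has_vector_derivative
      vector_derivative (snd c \<circ> ?\<gamma>) (at t within {0..1})) (at t within ?I)"
    unfolding at by (simp add: vector_derivative_works)
  have "((f \<circ> chart_inv c) has_derivative differential X f c (snd c (?\<gamma> t)))
      (at ((snd c \<circ> ?\<gamma>) t) within (snd c \<circ> ?\<gamma>) ` ?I)"
    using smooth_function_derivative[OF f c(1) chart_in_image[OF c(2)]]
    by (auto intro: has_derivative_at_withinI)
  note * = vector_derivative_diff_chain_within[OF v this]
  have velocity: "form_on_velocity X (differential X f) ?\<gamma> t =
      differential X f c (snd c (?\<gamma> t)) (vector_derivative (snd c \<circ> ?\<gamma>) (at t within {0..1}))"
    unfolding form_on_velocity_def c_def[symmetric] Let_def ..
  have "(f \<circ> ?\<gamma> has_vector_derivative form_on_velocity X (differential X f) ?\<gamma> t) (at t within ?I)"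
    unfolding velocity
    by (rule has_vector_derivative_transform[OF tI _ *]) (simp add: chart_inv_chart[OF c(1)])
  then show ?thesis by (simp only: at)
qed

lemma simplex_integral_differential:
  assumes "f \<in> smooth_functions X" "smooth_simplex1 X \<sigma>"
  shows "simplex_integral X (differential X f) \<sigma> = f (simplex_path \<sigma> 1) - f (simplex_path \<sigma> 0)"
  using fundamental_theorem_of_calculus[OF _ has_vector_derivative_along_path[OF assms]]
  by (simp add: simplex_integral_def integral_unique)

text \<open>
  The singular 2-simplices bounding \<open>c\<close> need not be smooth. Therefore the integral is compared with
  the coboundary of the primitive, which is defined on all singular simplices.
\<close>

lemma exact_form_integral_on_boundary:
  assumes "\<theta> \<in> exact_forms X" "c \<in> complex_boundaries 1 (space_of X)" "c \<in> smooth_chains1 X"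
  shows "chain_integral X \<theta> c = 0"
proof -
  obtain f where f: "f \<in> smooth_functions X" "\<theta> = differential X f"
    using assms(1) by (auto simp: exact_forms_def)
  let ?\<phi> = "coboundary 0 (space_of X) (vertex_cochain (space_of X) f)"
  have "simplex_integral X \<theta> \<sigma> = ?\<phi> (frag_of \<sigma>)" if "\<sigma> \<in> Poly_Mapping.keys c" for \<sigma>
  proof -
    have \<sigma>: "smooth_simplex1 X \<sigma>" using assms(3) that by (simp add: smooth_chains1_def)
    then have "singular_simplex 1 (space_of X) \<sigma>" by (simp add: smooth_simplex1_def)
    from coboundary_vertex_cochain[OF this] simplex_integral_differential[OF f(1) \<sigma>]
    show ?thesis by (simp add: f(2))
  qed
  then have "chain_integral X \<theta> c = evaluate ?\<phi> c"
    by (simp add: chain_integral_def evaluate_def)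
  also have "\<dots> = 0"
    by (rule evaluate_coboundary_on_boundary[OF _ assms(2)])
      (auto simp: singular_coboundaries_def vertex_cochain)
  finally show ?thesis .
qed

lemma kronecker_trivial:
  assumes "simply_connected_space (space_of X)"
  shows "kronecker 1 (space_of X) (singular_coboundaries 1 (space_of X)) = (\<lambda>_. 0)"
proof
  fix A
  let ?B = "singular_coboundaries 1 (space_of X)"
  show "kronecker 1 (space_of X) ?B A = 0"
  proof (cases "A = complex_boundaries 1 (space_of X)")
    case True
    have "(THE r. \<forall>\<phi>\<in>?B. \<forall>c\<in>A. evaluate \<phi> c = r) = 0"
    proof (rule the_equality)
      show "\<forall>\<phi>\<in>?B. \<forall>c\<in>A. evaluate \<phi> c = 0"
        using evaluate_coboundary_on_boundary True by blast
      fix r assume r: "\<forall>\<phi>\<in>?B. \<forall>c\<in>A. evaluate \<phi> c = r"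
      have "0 \<in> A" using True complex_boundaries_0 by blast
      moreover have "0 \<in> ?B" using zero_cocycle cocycles_subset_coboundaries[OF assms] by blast
      ultimately show "r = 0" using r by (force simp: evaluate_def)
    qed
    then show ?thesis by (simp add: kronecker_def)
  next
    case False
    then show ?thesis
      using complex_homology_1_trivial[OF assms] by (simp add: kronecker_def)
  qed
qed

lemma periods_trivial:
  assumes "simply_connected_space (space_of X)"
  shows "periods X (exact_forms X) = (\<lambda>_. 0)"
proof
  fix A
  show "periods X (exact_forms X) A = 0"
  proof (cases "A = complex_boundaries 1 (space_of X)")
    case True
    have "(THE r. \<forall>\<theta>\<in>exact_forms X. \<forall>c\<in>A \<inter> smooth_chains1 X. chain_integral X \<theta> c = r) = 0"
    proof (rule the_equality)
      show "\<forall>\<theta>\<in>exact_forms X. \<forall>c\<in>A \<inter> smooth_chains1 X. chain_integral X \<theta> c = 0"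
        using exact_form_integral_on_boundary True by blast
      fix r assume r: "\<forall>\<theta>\<in>exact_forms X. \<forall>c\<in>A \<inter> smooth_chains1 X. chain_integral X \<theta> c = r"
      have "0 \<in> A \<inter> smooth_chains1 X"
        using True complex_boundaries_0 by (auto simp: smooth_chains1_def)
      moreover have "(\<lambda>_. 0) \<in> smooth_functions X"
        by (simp add: smooth_functions_def o_def smooth_on_0)
      then have "differential X (\<lambda>_. 0) \<in> exact_forms X"
        unfolding exact_forms_def by blast
      ultimately show "r = 0" using r by (force simp: chain_integral_def)
    qed
    then show ?thesis by (simp add: periods_def)
  next
    case False
    then show ?thesis
      using complex_homology_1_trivial[OF assms] by (simp add: periods_def)
  qed
qed

lemma deRham_map_exact_forms:
  assumes "simply_connected_space (space_of X)"
  shows "deRham_map X (exact_forms X) = singular_coboundaries 1 (space_of X)"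
proof -
  let ?B = "singular_coboundaries 1 (space_of X)" and ?k = "kronecker 1 (space_of X)"
  have "deRham_map X (exact_forms X) = inv_into {?B} ?k (?k ?B)"
    unfolding deRham_map_def periods_trivial[OF assms] kronecker_trivial[OF assms]
      singular_cohomology_1_trivial(2)[OF assms] ..
  also have "\<dots> = ?B" by (rule inv_into_f_f) auto
  finally show ?thesis .
qed

end

theorem theorem12p2:
  fixes X :: "'a surface" and Xt :: "'b topology" and p :: "'b \<Rightarrow> 'a"
  assumes "riemann_surface X" and "compact_space (space_of X)"
    and "biholomorphic X CP1"
    and "simply_connected_space (space_of X)"
    and "universal_covering Xt (space_of X) p"
    and "trivial_group (deck_group Xt p)"
  shows "(\<not> trivial_group (singular_cohomology 1 (space_of X)) \<longleftrightarrow>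
            \<not> trivial_group (deRham_H1 X)) \<and>
         trivial_group (singular_cohomology 1 (space_of X)) \<and>
         deRham_map X \<in> hom (deRham_H1 X) (singular_cohomology 1 (space_of X)) \<and>
         kernel (deRham_H1 X) (singular_cohomology 1 (space_of X)) (deRham_map X) =
           {\<omega> \<in> carrier (deRham_H1 X).
              deRham_map X \<omega> = \<one>\<^bsub>singular_cohomology 1 (space_of X)\<^esub>} \<and>
         {\<omega> \<in> carrier (deRham_H1 X).
            deRham_map X \<omega> = \<one>\<^bsub>singular_cohomology 1 (space_of X)\<^esub>} =
           carrier (deRham_H1 X)"
proof -
  let ?H = "singular_cohomology 1 (space_of X)" and ?D = "deRham_H1 X"
  interpret surface X by standard (rule assms(1))
  note D = deRham_H1_trivial[OF assms(3)]
  note H = singular_cohomology_1_trivial[OF assms(4)]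
  have map: "deRham_map X (\<one>\<^bsub>?D\<^esub>) = \<one>\<^bsub>?H\<^esub>"
    using deRham_map_exact_forms[OF assms(4)] D(3) H(3) by simp
  have "deRham_map X \<in> hom ?D ?H"
  proof (rule homI)
    interpret D: group ?D using D(1) by (simp add: trivial_group_def)
    interpret H: group ?H using H(1) by (simp add: trivial_group_def)
    fix x y assume "x \<in> carrier ?D" "y \<in> carrier ?D"
    then have "x = \<one>\<^bsub>?D\<^esub>" "y = \<one>\<^bsub>?D\<^esub>" using D by auto
    then show "deRham_map X x \<in> carrier ?H"
      "deRham_map X (x \<otimes>\<^bsub>?D\<^esub> y) = deRham_map X x \<otimes>\<^bsub>?H\<^esub> deRham_map X y"
      using map by (simp_all del: One_nat_def)
  qed
  moreover have "deRham_map X \<omega> = \<one>\<^bsub>?H\<^esub>" if "\<omega> \<in> carrier ?D" for \<omega>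
    using that map D by simp
  ultimately show ?thesis
    using D(1) H(1) by (auto simp: kernel_def)
qed

end
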